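(* Let $\nu\in\mathbb{N}$, $\nu\ge1$, and let $\hat\Theta$ be a solution of the dual problem $\min\{J(\Theta):\Theta\in\mathcal{D}_B\}$. Then $\mathcal{B}_{\hat\Theta,\nu}$ is the closest spectral density to the correlogram $\Omega$, according to the divergence $\mathcal{S}_{B}^{(1-\nu^{-1})}(\Omega\|\mathcal{B}_{\Theta,\nu})$, among those belonging to the parametric class $\mathcal{M}_B=\{\mathcal{B}_{\Theta,\nu}:\Theta\in\mathcal{D}_B\}$; that is, $$\hat\Theta=\mathrm{argmin}_{\Theta\in\mathcal{D}_B}\ \mathcal{S}_{B}^{(1-\nu^{-1})}(\Omega\|\mathcal{B}_{\Theta,\nu}).$$
   Context: $\mathcal{S}_m^+$ is the set of $m\times m$ spectral densities of $\mathbb{R}^m$-valued stationary processes (Hermitian positive semidefinite functions on the unit circle, with $\Phi(e^{-i\vartheta})=\overline{\Phi(e^{i\vartheta})}$) that are bounded and coercive ($k_1I\preceq\Phi\preceq k_2I$ for some $k_1,k_2>0$). $\mathcal{Q}_n$ is the space of real symmetric $n\times n$ matrices. $\int$ is integration over the unit circle with respect to normalized Lebesgue measure; $*$ is conjugate transpose on the unit circle; inequalities between functions hold on the whole unit circle. Setting: $G(z)=(zI-A)^{-1}B$ with $A\in\mathbb{R}^{n\times n}$ having all eigenvalues in the open unit disc, $B\in\mathbb{R}^{n\times m}$, $n>m$, and $(A,B)$ reachable. $\Psi\in\mathcal{S}_m^+$ is a prior spectral density such that $\Psi$ and $\Psi^{\nu^{-1}}$ have bounded McMillan degree (are rational). $\Omega\succ0$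 is the (possibly truncated by the Blackman-Tukey method) biased correlogram computed from data $\mathrm{y}(1),\dots,\mathrm{y}(N)\in\mathbb{R}^m$ (a trigonometric matrix polynomial, so $\Omega\in\mathcal{S}_m^+$), and $\hat\Sigma=\int G\Omega G^*$. For $\Theta\in\mathcal{D}_B=\{\Theta\in\mathcal{Q}_n:\Psi^{-\nu^{-1}}+\nu^{-1}G^*\Theta G\succ0\}$ put $$\mathcal{B}_{\Theta,\nu}=(\Psi^{-\nu^{-1}}+\nu^{-1}G^*\Theta G)^{-\nu},$$ and define the dual function $$J(\Theta)=\mathrm{tr}\int\log(\Psi^{-1}+G^*\Theta G)^{-1}+\mathrm{tr}(\hat\Sigma\Theta)\quad(\nu=1),$$ $$J(\Theta)=\tfrac{\nu}{\nu-1}\mathrm{tr}\int(\Psi^{-\nu^{-1}}+\nu^{-1}G^*\Theta G)^{1-\nu}+\mathrm{tr}(\hat\Sigma\Theta)\quad(\nu>1).$$ It is known that the dual problem $\min_{\mathcal{D}_B}J$ admits solutions and that $\mathcal{B}_{\hat\Theta,\nu}$ is the unique minimizer of $\mathcal{S}_B^{(1-\nu^{-1})}(\Phi\|\Psi)$ over $\Phi\in\mathcal{S}_m^+$ subject to $\int G\Phi G^*=\hat\Sigma$. Beta divergence: for $\beta\in\mathbb{R}\setminus\{0,1\}$, $\mathcal{S}_B^{(\beta)}(\Phi_1\|\Phi_2)=\mathrm{tr}\int[\frac{1}{\beta(\beta-1)}\Phi_1^\beta-\frac{1}{\beta-1}\Phi_1\Phi_2^{\beta-1}+\frac1\beta\Phi_2^\beta]$;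 for $\beta=0$, by continuity, $\mathcal{S}_B^{(0)}(\Phi_1\|\Phi_2)=\mathcal{S}_{IS}(\Phi_1\|\Phi_2)=\mathrm{tr}\int[\log\Phi_2-\log\Phi_1+\Phi_1\Phi_2^{-1}-I]$. *)

theory Defs
  imports "HOL-Analysis.Analysis" "HOL-Computational_Algebra.Polynomial"
begin

definition ctranspose :: "complex^'n^'m \<Rightarrow> complex^'m^'n"
  where "ctranspose X = (\<chi> i j. cnj (X $ j $ i))"

definition hermitian :: "complex^'n^'n \<Rightarrow> bool"
  where "hermitian X \<longleftrightarrow> ctranspose X = X"

text \<open>The inner product of \<open>complex^'n\<close> in the library is the real one, so
  \<open>v \<bullet> (X *v v)\<close> is the real part of \<open>v\<^sup>* X v\<close>; for Hermitian \<open>X\<close> the two coincide.\<close>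

definition psd :: "complex^'n^'n \<Rightarrow> bool"
  where "psd X \<longleftrightarrow> hermitian X \<and> (\<forall>v. 0 \<le> v \<bullet> (X *v v))"

definition posdef :: "complex^'n^'n \<Rightarrow> bool"
  where "posdef X \<longleftrightarrow> hermitian X \<and> (\<forall>v. v \<noteq> 0 \<longrightarrow> 0 < v \<bullet> (X *v v))"

definition unitary :: "complex^'n^'n \<Rightarrow> bool"
  where "unitary U \<longleftrightarrow> ctranspose U ** U = mat 1 \<and> U ** ctranspose U = mat 1"

definition real_diag :: "('n \<Rightarrow> real) \<Rightarrow> complex^'n^'n"
  where "real_diag d = (\<chi> i j. if i = j then of_real (d i) else 0)"

text \<open>\<open>herm_fun f X\<close> is \<open>f(X)\<close> for Hermitian \<open>X\<close>: apply \<open>f\<close> to the eigenvalues in a unitary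
  diagonalisation. The lemma \<open>herm_fun_diag\<close> shows that the choice of diagonalisation is
  irrelevant.\<close>

definition herm_fun :: "(real \<Rightarrow> real) \<Rightarrow> complex^'n^'n \<Rightarrow> complex^'n^'n"
  where "herm_fun f X =
    (THE Y. \<exists>U d. unitary U \<and> X = U ** real_diag d ** ctranspose U
                \<and> Y = U ** real_diag (\<lambda>i. f (d i)) ** ctranspose U)"

definition mat_powr :: "complex^'n^'n \<Rightarrow> real \<Rightarrow> complex^'n^'n"
  where "mat_powr X p = herm_fun (\<lambda>x. x powr p) X"

definition mat_log :: "complex^'n^'n \<Rightarrow> complex^'n^'n"
  where "mat_log X = herm_fun ln X"

lemma real_diag_mult_left: "(real_diag d ** X) $ i $ j = of_real (d i) * X $ i $ j"
  by (simp add: matrix_matrix_mult_def real_diag_def if_distrib[where f = "\<lambda>x. x * _"] cong: if_cong)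

lemma real_diag_mult_right: "(X ** real_diag d) $ i $ j = X $ i $ j * of_real (d j)"
  by (simp add: matrix_matrix_mult_def real_diag_def if_distrib[where f = "\<lambda>x. _ * x"] cong: if_cong)

lemma herm_fun_diag_unique:
  assumes U: "unitary U" and V: "unitary V"
    and eq: "U ** real_diag d ** ctranspose U = V ** real_diag e ** ctranspose V"
  shows "U ** real_diag (\<lambda>i. f (d i)) ** ctranspose U
       = V ** real_diag (\<lambda>i. f (e i)) ** ctranspose V"
proof -
  define W where "W = ctranspose V ** U"
  have UU: "ctranspose U ** U = mat 1" "U ** ctranspose U = mat 1"
    and VV: "ctranspose V ** V = mat 1" "V ** ctranspose V = mat 1"
    using U V by (auto simp: unitary_def)
  have "W ** real_diag d = ctranspose V ** (U ** real_diag d ** ctranspose U) ** U"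
    by (simp add: W_def matrix_mul_assoc[symmetric] UU)
  also have "\<dots> = real_diag e ** W"
    unfolding eq by (simp add: W_def matrix_mul_assoc VV)
  finally have "W $ i $ j * of_real (d j) = of_real (e i) * W $ i $ j" for i j
    by (metis real_diag_mult_left real_diag_mult_right)
  hence ent: "W $ i $ j = 0 \<or> d j = e i" for i j
    by (metis mult.commute mult_cancel_left of_real_eq_iff)
  have "W ** real_diag (\<lambda>i. f (d i)) = real_diag (\<lambda>i. f (e i)) ** W"
    unfolding vec_eq_iff real_diag_mult_left real_diag_mult_right
    using ent by (metis mult.commute mult_zero_left)
  hence "V ** (W ** real_diag (\<lambda>i. f (d i))) ** ctranspose U
       = V ** (real_diag (\<lambda>i. f (e i)) ** W) ** ctranspose U"
    by simp
  moreover have "V ** (W ** real_diag (\<lambda>i. f (d i))) ** ctranspose U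
       = U ** real_diag (\<lambda>i. f (d i)) ** ctranspose U"
    by (simp add: W_def matrix_mul_assoc VV)
  moreover have "V ** (real_diag (\<lambda>i. f (e i)) ** W) ** ctranspose U
       = V ** real_diag (\<lambda>i. f (e i)) ** ctranspose V"
    by (simp add: W_def matrix_mul_assoc[symmetric] UU)
  ultimately show ?thesis by simp
qed

lemma herm_fun_diag:
  assumes "unitary U"
  shows "herm_fun f (U ** real_diag d ** ctranspose U)
       = U ** real_diag (\<lambda>i. f (d i)) ** ctranspose U"
  unfolding herm_fun_def
proof (rule the_equality)
  show "\<exists>U' d'. unitary U' \<and> U ** real_diag d ** ctranspose U = U' ** real_diag d' ** ctranspose U'
          \<and> U ** real_diag (\<lambda>i. f (d i)) ** ctranspose U
            = U' ** real_diag (\<lambda>i. f (d' i)) ** ctranspose U'"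
    using assms by blast
next
  fix Y
  assume "\<exists>U' d'. unitary U' \<and> U ** real_diag d ** ctranspose U = U' ** real_diag d' ** ctranspose U'
          \<and> Y = U' ** real_diag (\<lambda>i. f (d' i)) ** ctranspose U'"
  then show "Y = U ** real_diag (\<lambda>i. f (d i)) ** ctranspose U"
    using herm_fun_diag_unique[OF assms, of _ d _ f] by metis
qed

text \<open>Functions on the unit circle are modelled as functions on \<open>complex\<close>; only their values on
  \<open>sphere 0 1\<close> matter.\<close>

definition circle_integral ::
  "(complex \<Rightarrow> 'a::{banach, second_countable_topology}) \<Rightarrow> 'a"
  where "circle_integral F = (1 / (2 * pi)) *\<^sub>R (LINT \<theta>:{-pi..pi}|lborel. F (cis \<theta>))"

definition spectral_densities :: "(complex \<Rightarrow> complex^'m^'m) set"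
  where "spectral_densities =
    {\<Phi>. (\<lambda>\<theta>. \<Phi> (cis \<theta>)) \<in> borel_measurable borel
       \<and> (\<forall>z\<in>sphere 0 1. psd (\<Phi> z) \<and> \<Phi> (cnj z) = map_matrix cnj (\<Phi> z))
       \<and> (\<exists>k1 k2 :: real. 0 < k1 \<and> 0 < k2 \<and>
            (\<forall>z\<in>sphere 0 1. psd (\<Phi> z - mat (of_real k1)) \<and> psd (mat (of_real k2) - \<Phi> z)))}"

definition rational_on_circle :: "(complex \<Rightarrow> complex^'m^'k) \<Rightarrow> bool"
  where "rational_on_circle F \<longleftrightarrow>
    (\<forall>i j. \<exists>p q :: complex poly. \<forall>z\<in>sphere 0 1.
       poly q z \<noteq> 0 \<and> F z $ i $ j = poly p z / poly q z)"

text \<open>The beta divergence for \<open>\<beta> \<noteq> 1\<close>; the case \<open>\<beta> = 0\<close> is the Itakura-Saito distance.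
  For Hermitian arguments the trace is real, so taking the real part loses nothing. At \<open>\<beta> = 1\<close>
  the formula is meaningless.\<close>

definition is_div :: "(complex \<Rightarrow> complex^'m^'m) \<Rightarrow> (complex \<Rightarrow> complex^'m^'m) \<Rightarrow> real"
  where "is_div \<Phi>1 \<Phi>2 = Re (trace (circle_integral
    (\<lambda>z. mat_log (\<Phi>2 z) - mat_log (\<Phi>1 z) + \<Phi>1 z ** matrix_inv (\<Phi>2 z) - mat 1)))"

definition beta_div ::
  "real \<Rightarrow> (complex \<Rightarrow> complex^'m^'m) \<Rightarrow> (complex \<Rightarrow> complex^'m^'m) \<Rightarrow> real"
  where "beta_div \<beta> \<Phi>1 \<Phi>2 =
    (if \<beta> = 0 then is_div \<Phi>1 \<Phi>2
     else Re (trace (circle_integral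
       (\<lambda>z. (1 / (\<beta> * (\<beta> - 1))) *\<^sub>R mat_powr (\<Phi>1 z) \<beta>
          - (1 / (\<beta> - 1)) *\<^sub>R (\<Phi>1 z ** mat_powr (\<Phi>2 z) (\<beta> - 1))
          + (1 / \<beta>) *\<^sub>R mat_powr (\<Phi>2 z) \<beta>))))"

text \<open>\<open>sample_cov N y k\<close> is \<open>1/N\<close> times the sum of \<open>y(t) y(t-k)\<^sup>T\<close> over all \<open>t\<close> with both \<open>t\<close>
  and \<open>t - k\<close> in \<open>{1..N}\<close>; here \<open>k\<close> may be negative.\<close>

definition sample_cov :: "nat \<Rightarrow> (nat \<Rightarrow> real^'m) \<Rightarrow> int \<Rightarrow> real^'m^'m"
  where "sample_cov N y k =
    (\<chi> i j. (1 / real N) *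
       (\<Sum>(t, s) \<in> {(t, s). t \<in> {1..N} \<and> s \<in> {1..N} \<and> int t - int s = k}. y t $ i * y s $ j))"

text \<open>Blackman-Tukey lag windows of width \<open>M\<close>. The untruncated biased correlogram is the case
  \<open>M = N\<close> with \<open>w k = 1\<close> for \<open>\<bar>k\<bar> < N\<close>.\<close>

definition lag_window :: "nat \<Rightarrow> (int \<Rightarrow> real) \<Rightarrow> bool"
  where "lag_window M w \<longleftrightarrow> w 0 = 1 \<and> (\<forall>k. w (- k) = w k) \<and> (\<forall>k. \<bar>k\<bar> \<ge> int M \<longrightarrow> w k = 0)"

definition correlogram ::
  "nat \<Rightarrow> (nat \<Rightarrow> real^'m) \<Rightarrow> (int \<Rightarrow> real) \<Rightarrow> complex \<Rightarrow> complex^'m^'m"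
  where "correlogram N y w z =
    (\<chi> i j. \<Sum>k \<in> {- int N <..< int N}. of_real (w k * sample_cov N y k $ i $ j) * z powi (- k))"

definition schur_stable :: "real^'n^'n \<Rightarrow> bool"
  where "schur_stable A \<longleftrightarrow>
    (\<forall>c :: complex. \<forall>v. v \<noteq> 0 \<and> map_matrix of_real A *v v = c *s v \<longrightarrow> norm c < 1)"

definition reachable :: "real^'n^'n \<Rightarrow> real^'m^'n \<Rightarrow> bool"
  where "reachable A B \<longleftrightarrow>
    span (\<Union>k<CARD('n). columns (((\<lambda>X. A ** X) ^^ k) B)) = UNIV"

definition Gtf :: "real^'n^'n \<Rightarrow> real^'m^'n \<Rightarrow> complex \<Rightarrow> complex^'m^'n"
  where "Gtf A B z = matrix_inv (mat z - map_matrix of_real A) ** map_matrix of_real B"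

definition state_cov ::
  "real^'n^'n \<Rightarrow> real^'m^'n \<Rightarrow> (complex \<Rightarrow> complex^'m^'m) \<Rightarrow> complex^'n^'n"
  where "state_cov A B \<Phi> = circle_integral (\<lambda>z. Gtf A B z ** \<Phi> z ** ctranspose (Gtf A B z))"

definition GTG :: "real^'n^'n \<Rightarrow> real^'m^'n \<Rightarrow> real^'n^'n \<Rightarrow> complex \<Rightarrow> complex^'m^'m"
  where "GTG A B \<Theta> z = ctranspose (Gtf A B z) ** map_matrix of_real \<Theta> ** Gtf A B z"

definition pencil ::
  "real^'n^'n \<Rightarrow> real^'m^'n \<Rightarrow> (complex \<Rightarrow> complex^'m^'m) \<Rightarrow> nat \<Rightarrow> real^'n^'n
     \<Rightarrow> complex \<Rightarrow> complex^'m^'m"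
  where "pencil A B \<Psi> \<nu> \<Theta> z =
    mat_powr (\<Psi> z) (- (1 / real \<nu>)) + (1 / real \<nu>) *\<^sub>R GTG A B \<Theta> z"

definition dual_domain ::
  "real^'n^'n \<Rightarrow> real^'m^'n \<Rightarrow> (complex \<Rightarrow> complex^'m^'m) \<Rightarrow> nat \<Rightarrow> (real^'n^'n) set"
  where "dual_domain A B \<Psi> \<nu> =
    {\<Theta>. transpose \<Theta> = \<Theta> \<and> (\<forall>z\<in>sphere 0 1. posdef (pencil A B \<Psi> \<nu> \<Theta> z))}"

definition beta_density ::
  "real^'n^'n \<Rightarrow> real^'m^'n \<Rightarrow> (complex \<Rightarrow> complex^'m^'m) \<Rightarrow> nat \<Rightarrow> real^'n^'n
     \<Rightarrow> complex \<Rightarrow> complex^'m^'m"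
  where "beta_density A B \<Psi> \<nu> \<Theta> z = mat_powr (pencil A B \<Psi> \<nu> \<Theta> z) (- real \<nu>)"

definition beta_class ::
  "real^'n^'n \<Rightarrow> real^'m^'n \<Rightarrow> (complex \<Rightarrow> complex^'m^'m) \<Rightarrow> nat
     \<Rightarrow> (complex \<Rightarrow> complex^'m^'m) set"
  where "beta_class A B \<Psi> \<nu> = beta_density A B \<Psi> \<nu> ` dual_domain A B \<Psi> \<nu>"

definition dual_fun ::
  "real^'n^'n \<Rightarrow> real^'m^'n \<Rightarrow> (complex \<Rightarrow> complex^'m^'m) \<Rightarrow> nat \<Rightarrow> complex^'n^'n
     \<Rightarrow> real^'n^'n \<Rightarrow> real"
  where "dual_fun A B \<Psi> \<nu> S \<Theta> =
    (if \<nu> = 1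
     then Re (trace (circle_integral (\<lambda>z. mat_log (matrix_inv (matrix_inv (\<Psi> z) + GTG A B \<Theta> z)))))
        + Re (trace (S ** map_matrix of_real \<Theta>))
     else (real \<nu> / (real \<nu> - 1))
            * Re (trace (circle_integral (\<lambda>z. mat_powr (pencil A B \<Psi> \<nu> \<Theta> z) (1 - real \<nu>))))
        + Re (trace (S ** map_matrix of_real \<Theta>)))"

end

theory Submission
  imports Defs
begin

text \<open>
  Write \<open>P\<close> for the pencil of \<open>\<Theta>\<close>, so that the density of \<open>\<Theta>\<close> is \<open>P\<^sup>-\<^sup>\<nu>\<close>. The exponent
  \<open>\<beta> = 1 - 1/\<nu>\<close> is chosen such that \<open>(P\<^sup>-\<^sup>\<nu>)\<^sup>\<beta>\<^sup>-\<^sup>1 = P\<close>. The cross term of the divergence between \<open>\<Omega>\<close>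
  and the density is thus affine in \<open>\<Theta>\<close>; its \<open>\<Theta>\<close>-part is the trace of \<open>\<Theta>\<close> against the state
  covariance of \<open>\<Omega>\<close>, and the other \<open>\<Theta>\<close>-dependent term is the nonlinear part of the dual
  function. Hence the divergence and the dual function differ by a constant
  (\<open>beta_div_eq_dual_fun_plus_const\<close>) and have the same minimisers.

  Uniqueness of the density is strict convexity. The nonlinear part of the dual function is the
  integral of \<open>trace (\<phi> P)\<close> for a strictly convex scalar function \<open>\<phi>\<close> (\<open>dual_potential\<close>).
  Klein's inequality (\<open>klein_inequality\<close>) lifts strict convexity from \<open>\<phi>\<close> to its trace function. At
  the midpoint of two minimisers the convexity gap of the integrand is then continuous, nonnegative
  and of zero integral, so it vanishes on the whole circle and the two pencils coincide
  (\<open>dual_minimizers_same_pencil\<close>).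

  Splitting the integrals requires integrability of every term, and the membership in the class of
  spectral densities requires measurability and coercivity. All of this follows from
  continuity on the circle, by way of continuity of the functional calculus on positive definite
  matrices (\<open>continuous_on_herm_fun\<close>), which rests on the spectral theorem
  (\<open>hermitian_unitary_diagonalization\<close>) and on compactness of the unitary group.
\<close>

section \<open>Unitary diagonalisation of Hermitian matrices\<close>

text \<open>The complex inner product, conjugate-linear on the left. Eigenspaces are complex subspaces, so
  orthogonality of eigenvectors has to be expressed with it and not with its real part \<open>\<bullet>\<close>.\<close>

definition cip :: "complex^'n \<Rightarrow> complex^'n \<Rightarrow> complex"
  where "cip u v = (\<Sum>k\<in>UNIV. cnj (u $ k) * v $ k)"

lemma inner_eq_Re_cip: "u \<bullet> v = Re (cip u v)"
  by (simp add: cip_def inner_vec_def inner_complex_def)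

lemma cip_self: "cip u u = of_real (u \<bullet> u)"
  by (simp add: cip_def inner_vec_def inner_complex_def complex_eq_iff algebra_simps)

lemma cip_commute: "cip v u = cnj (cip u v)"
  by (simp add: cip_def mult.commute)

lemma cip_add_right: "cip u (v + w) = cip u v + cip u w"
  and cip_scale_left: "cip (c *s u) v = cnj c * cip u v"
  by (simp_all add: cip_def algebra_simps sum.distrib sum_subtractf sum_distrib_left)

lemma cip_scaleR_right: "cip u (r *\<^sub>R v) = of_real r * cip u v"
  by (simp add: cip_def scaleR_sum_right flip: scaleR_conv_of_real)

lemma cip_adjoint: "cip u (X *v v) = cip (ctranspose X *v u) v"
proof -
  have "cip u (X *v v) = (\<Sum>k\<in>UNIV. \<Sum>j\<in>UNIV. cnj (u $ k) * (X $ k $ j * v $ j))"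
    by (simp add: cip_def matrix_vector_mult_def sum_distrib_left)
  also have "\<dots> = (\<Sum>j\<in>UNIV. \<Sum>k\<in>UNIV. cnj (u $ k) * (X $ k $ j * v $ j))"
    by (rule sum.swap)
  also have "\<dots> = cip (ctranspose X *v u) v"
    by (simp add: cip_def matrix_vector_mult_def ctranspose_def sum_distrib_right sum_distrib_left mult_ac)
  finally show ?thesis .
qed

lemma ctranspose_mult: "ctranspose (X ** Y) = ctranspose Y ** ctranspose X"
  by (simp add: ctranspose_def matrix_matrix_mult_def vec_eq_iff mult.commute)

lemma ctranspose_ctranspose: "ctranspose (ctranspose X) = X"
  by (simp add: ctranspose_def vec_eq_iff)

lemma ctranspose_simps:
  "ctranspose (X + Y) = ctranspose X + ctranspose Y"
  "ctranspose (X - Y) = ctranspose X - ctranspose Y"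
  "ctranspose (r *\<^sub>R X) = r *\<^sub>R ctranspose X"
  "ctranspose (real_diag d) = real_diag d"
  "ctranspose (mat (of_real r)) = mat (of_real r)"
  by (auto simp: ctranspose_def vec_eq_iff real_diag_def mat_def)

lemma continuous_on_matrix_vector_mult [continuous_intros]:
  fixes F :: "'a::topological_space \<Rightarrow> complex^'n^'m"
  assumes "continuous_on S F" "continuous_on S g"
  shows "continuous_on S (\<lambda>x. F x *v g x)"
  unfolding matrix_vector_mult_def by (intro continuous_intros assms)

lemma matrix_vector_scaleR: "X *v (r *\<^sub>R v) = r *\<^sub>R (X *v (v :: complex^'n))"
  by (simp add: matrix_vector_mult_def vec_eq_iff scaleR_sum_right)

lemma hermitian_inner: "hermitian X \<Longrightarrow> u \<bullet> (X *v v) = (X *v u) \<bullet> v"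
  by (simp add: inner_eq_Re_cip cip_adjoint hermitian_def)

text \<open>First-order optimality in the form in which the Rayleigh quotient needs it: a linear term that
  survived would dominate the quadratic one for small \<open>t\<close> of the right sign.\<close>

lemma linear_coeff_zero_if_quadratic_nonpos:
  fixes a b :: real
  assumes "\<And>t. 2 * t * a + t\<^sup>2 * b \<le> 0"
  shows "a = 0"
proof (rule ccontr)
  assume a: "a \<noteq> 0"
  define c where "c = \<bar>b\<bar> + 1"
  have c: "c > 0" "2 * c + b > 0" by (auto simp: c_def)
  have "2 * (a / c) * a + (a / c)\<^sup>2 * b = (a / c)\<^sup>2 * (2 * c + b)"
    using c by (simp add: field_simps power2_eq_square)
  also have "\<dots> > 0" using a c by simp
  finally show False using assms[of "a / c"] by linarith
qed

text \<open>The orthogonal complement \<open>W\<close> of eigenvectors is invariant under a Hermitian matrix, so a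
  maximiser of the quadratic form on the unit sphere of \<open>W\<close> is again an eigenvector: the residual
  \<open>X v - l v\<close> lies in \<open>W\<close> and, by optimality, is orthogonal to all of \<open>W\<close>.\<close>

lemma hermitian_eigenvector_orthogonal:
  fixes X :: "complex^'n^'n"
  assumes X: "hermitian X"
    and u: "\<And>i. i \<in> I \<Longrightarrow> X *v u i = of_real (d i) *s u i"
    and w: "w \<noteq> 0" "\<And>i. i \<in> I \<Longrightarrow> cip (u i) w = 0"
  shows "\<exists>v l. (\<forall>i\<in>I. cip (u i) v = 0) \<and> v \<bullet> v = 1 \<and> X *v v = of_real l *s v"
proof -
  define W where "W = {v. \<forall>i\<in>I. cip (u i) v = 0}"
  define q where "q v = v \<bullet> (X *v v)" for v
  have cont_cip: "continuous_on UNIV (\<lambda>v. cip (u i) v)" for i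
    unfolding cip_def by (intro continuous_intros)
  have W_eq: "W = (\<Inter>i\<in>I. {v. cip (u i) v = 0})"
    by (auto simp: W_def)
  have "closed W"
    unfolding W_eq by (intro closed_INT ballI closed_Collect_eq cont_cip continuous_on_const)
  hence K: "compact (W \<inter> sphere 0 1)"
    by (intro closed_Int_compact) auto
  have scale: "r *\<^sub>R v \<in> W" if "v \<in> W" for r v
    using that by (simp add: W_def cip_scaleR_right)
  have add: "v + v' \<in> W" if "v \<in> W" "v' \<in> W" for v v'
    using that by (simp add: W_def cip_add_right)
  have XW: "X *v v \<in> W" if "v \<in> W" for v
    using that X u by (simp add: W_def cip_adjoint hermitian_def cip_scale_left)
  have "w \<in> W" using w by (simp add: W_def)
  hence "(1 / norm w) *\<^sub>R w \<in> W \<inter> sphere 0 1"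
    using w(1) scale by (auto simp: dist_norm)
  moreover have "continuous_on (W \<inter> sphere 0 1) q"
    unfolding q_def by (intro continuous_intros)
  ultimately obtain v where "v \<in> W \<inter> sphere 0 1" "\<forall>x\<in>W \<inter> sphere 0 1. q x \<le> q v"
    using continuous_attains_sup[OF K, of q] by blast
  hence v: "v \<in> W" "norm v = 1" and max: "\<And>x. x \<in> W \<Longrightarrow> norm x = 1 \<Longrightarrow> q x \<le> q v"
    by auto
  define l where "l = q v"
  have q_scale: "q (r *\<^sub>R x) = r\<^sup>2 * q x" for r x
    by (simp add: q_def matrix_vector_scaleR power2_eq_square)
  have q_le: "q x \<le> l * (x \<bullet> x)" if "x \<in> W" for x
  proof (cases "x = 0")
    case False
    hence "q ((1 / norm x) *\<^sub>R x) \<le> l"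
      unfolding l_def using that scale by (intro max) auto
    thus ?thesis using False
      by (simp add: q_scale field_simps power2_norm_eq_inner)
  qed (simp add: q_def)
  define r where "r = X *v v - l *\<^sub>R v"
  \<comment> \<open>Along every line \<open>v + t h\<close> in \<open>W\<close> the function \<open>q - l * norm\<^sup>2\<close> is nonpositive and vanishes at \<open>t = 0\<close>.\<close>
  have ortho: "h \<bullet> r = 0" if h: "h \<in> W" for h
  proof (rule linear_coeff_zero_if_quadratic_nonpos[where b = "q h - l * (h \<bullet> h)"])
    fix t :: real
    define x where "x = v + t *\<^sub>R h"
    have "x \<in> W" unfolding x_def using h v add scale by blast
    hence le: "q x \<le> l * (x \<bullet> x)" by (rule q_le)
    have "q x = l + 2 * t * (h \<bullet> (X *v v)) + t\<^sup>2 * q h"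
      using hermitian_inner[OF X, of v h]
      by (simp add: x_def q_def l_def matrix_vector_scaleR matrix_vector_right_distrib
          inner_add_left inner_add_right power2_eq_square inner_commute algebra_simps)
    moreover have "x \<bullet> x = 1 + 2 * t * (h \<bullet> v) + t\<^sup>2 * (h \<bullet> h)"
      using v(2) by (simp add: x_def inner_add_left inner_add_right power2_eq_square
          inner_commute norm_eq_1 algebra_simps)
    ultimately show "2 * t * (h \<bullet> r) + t\<^sup>2 * (q h - l * (h \<bullet> h)) \<le> 0"
      using le by (simp add: r_def inner_diff_right algebra_simps)
  qed
  have "r = X *v v + (- l) *\<^sub>R v" by (simp add: r_def)
  hence "r \<in> W" using v(1) XW add scale by metis
  hence "r \<bullet> r = 0" by (rule ortho)
  hence "X *v v = of_real l *s v"
    by (simp add: r_def vec_eq_iff scaleR_conv_of_real[where 'a = complex])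
  moreover have "v \<bullet> v = 1" using v(2) by (simp add: norm_eq_1)
  ultimately show ?thesis using v(1) by (auto simp: W_def)
qed

text \<open>Eigenvectors are indexed by the index type of the matrix itself, so that for \<open>I = UNIV\<close> they are
  the columns of a square matrix.\<close>

lemma hermitian_orthonormal_eigenvectors:
  fixes X :: "complex^'n^'n" and I :: "'n set"
  assumes X: "hermitian X"
  shows "\<exists>u d. (\<forall>i\<in>I. X *v u i = of_real (d i) *s u i) \<and>
           (\<forall>i\<in>I. \<forall>j\<in>I. cip (u i) (u j) = (if i = j then 1 else 0))"
  using finite[of I]
proof (induction I rule: finite_induct)
  case empty
  show ?case by simp
next
  case (insert k I)
  then obtain u :: "'n \<Rightarrow> complex^'n" and d :: "'n \<Rightarrow> real"
    where u: "\<And>i. i \<in> I \<Longrightarrow> X *v u i = of_real (d i) *s u i"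
      and on: "\<And>i j. i \<in> I \<Longrightarrow> j \<in> I \<Longrightarrow> cip (u i) (u j) = (if i = j then 1 else 0)"
    by blast
  \<comment> \<open>A matrix whose kernel consists of the vectors orthogonal to all \<open>u i\<close>; its row \<open>k\<close> is zero, so
    the kernel is nontrivial.\<close>
  define Z :: "complex^'n^'n" where "Z = (\<chi> i j. if i \<in> I then cnj (u i $ j) else 0)"
  have "row k Z = 0" using insert by (simp add: row_def Z_def vec_eq_iff)
  hence "det Z = 0" by (rule det_zero_row)
  hence "\<not> invertible Z" by (simp add: invertible_det_nz)
  then obtain w where w: "w \<noteq> 0" "Z *v w = 0"
    using matrix_left_invertible_ker[of Z] invertible_left_inverse[of Z] by blast
  have w_orth: "cip (u i) w = 0" if "i \<in> I" for i
    using arg_cong[OF w(2), of "\<lambda>v. v $ i"] that by (simp add: Z_def cip_def matrix_vector_mult_def)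
  obtain v l where v: "\<And>i. i \<in> I \<Longrightarrow> cip (u i) v = 0" "v \<bullet> v = 1" "X *v v = of_real l *s v"
    using hermitian_eigenvector_orthogonal[of X I u d, OF X u w(1) w_orth] by auto
  have v': "cip v (u i) = 0" if "i \<in> I" for i
    using v(1)[OF that] cip_commute[of v "u i"] by simp
  have vv: "cip v v = 1" using v(2) by (simp add: cip_self)
  have k: "i \<noteq> k" if "i \<in> I" for i using that \<open>k \<notin> I\<close> by blast
  show ?case
    using u on v(1,3) vv v' k \<open>k \<notin> I\<close>
    by (intro exI[of _ "u(k := v)"] exI[of _ "d(k := l)"]) auto
qed

theorem hermitian_unitary_diagonalization:
  fixes X :: "complex^'n^'n"
  assumes "hermitian X"
  obtains U d where "unitary U" "X = U ** real_diag d ** ctranspose U"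
proof -
  obtain u :: "'n \<Rightarrow> complex^'n" and d where u: "\<And>i. X *v u i = of_real (d i) *s u i"
    and on: "\<And>i j. cip (u i) (u j) = (if i = j then 1 else 0)"
    using hermitian_orthonormal_eigenvectors[OF assms, of UNIV] by auto
  define U :: "complex^'n^'n" where "U = (\<chi> i j. u j $ i)"
  have UU: "ctranspose U ** U = mat 1"
    using on by (simp add: U_def ctranspose_def matrix_matrix_mult_def vec_eq_iff mat_def cip_def)
  hence UU': "U ** ctranspose U = mat 1"
    using matrix_left_right_inverse by blast
  have "X ** U = U ** real_diag d"
  proof -
    have "(X ** U) $ i $ j = (X *v u j) $ i" for i j
      by (simp add: matrix_matrix_mult_def matrix_vector_mult_def U_def)
    thus ?thesis
      by (simp add: vec_eq_iff real_diag_mult_right u) (simp add: U_def mult.commute)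
  qed
  hence "X = U ** real_diag d ** ctranspose U"
    by (metis UU' matrix_mul_assoc matrix_mul_rid)
  thus thesis using that UU UU' by (auto simp: unitary_def)
qed

section \<open>Functional calculus on positive definite matrices\<close>

lemma tendsto_matrix_mult [tendsto_intros]:
  fixes F :: "'a \<Rightarrow> complex^'n^'m" and G :: "'a \<Rightarrow> complex^'k^'n"
  assumes "(F \<longlongrightarrow> X) net" "(G \<longlongrightarrow> Y) net"
  shows "((\<lambda>x. F x ** G x) \<longlongrightarrow> X ** Y) net"
  unfolding matrix_matrix_mult_def by (intro tendsto_intros assms)

lemma tendsto_ctranspose [tendsto_intros]:
  "(F \<longlongrightarrow> X) net \<Longrightarrow> ((\<lambda>x. ctranspose (F x)) \<longlongrightarrow> ctranspose X) net"
  unfolding ctranspose_def by (intro tendsto_intros)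

lemma continuous_on_matrix_mult [continuous_intros]:
  fixes F :: "'a::topological_space \<Rightarrow> complex^'n^'m" and G :: "'a \<Rightarrow> complex^'k^'n"
  shows "continuous_on S F \<Longrightarrow> continuous_on S G \<Longrightarrow> continuous_on S (\<lambda>x. F x ** G x)"
  by (auto simp: continuous_on_def intro: tendsto_intros)

lemma continuous_on_ctranspose [continuous_intros]:
  "continuous_on S F \<Longrightarrow> continuous_on S (\<lambda>x. ctranspose (F x))"
  by (auto simp: continuous_on_def intro: tendsto_intros)

lemma hermitian_conjugate_diag: "hermitian (U ** real_diag d ** ctranspose U)"
  by (simp add: hermitian_def ctranspose_mult ctranspose_ctranspose ctranspose_simps matrix_mul_assoc)

lemma inner_conjugate_diag:
  fixes U :: "complex^'n^'n"
  shows "v \<bullet> ((U ** real_diag d ** ctranspose U) *v v)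
     = (\<Sum>i\<in>UNIV. d i * (norm ((ctranspose U *v v) $ i))\<^sup>2)"
proof -
  have "v \<bullet> ((U ** real_diag d ** ctranspose U) *v v)
      = Re (cip (ctranspose U *v v) (real_diag d *v (ctranspose U *v v)))"
    by (simp add: inner_eq_Re_cip cip_adjoint[of _ U] flip: matrix_vector_mul_assoc)
  also have "(real_diag d *v w) $ i = of_real (d i) * w $ i" for w :: "complex^'n" and i
    by (simp add: matrix_vector_mult_def real_diag_def if_distrib[where f = "\<lambda>x. x * _"] cong: if_cong)
  hence "Re (cip w (real_diag d *v w)) = (\<Sum>i\<in>UNIV. d i * (norm (w $ i))\<^sup>2)" for w :: "complex^'n"
    by (simp add: cip_def cmod_power2 algebra_simps) (simp add: power2_eq_square algebra_simps)
  finally show ?thesis .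
qed

lemma posdef_conjugate_diag_iff:
  fixes U :: "complex^'n^'n"
  assumes U: "unitary U"
  shows "posdef (U ** real_diag d ** ctranspose U) \<longleftrightarrow> (\<forall>i. 0 < d i)"
proof
  assume pd: "posdef (U ** real_diag d ** ctranspose U)"
  show "\<forall>i. 0 < d i"
  proof
    fix i
    define v where "v = U *v axis i 1"
    have v: "ctranspose U *v v = axis i 1"
      using U by (simp add: v_def matrix_vector_mul_assoc unitary_def)
    hence "v \<noteq> 0" by (metis axis_eq_0_iff matrix_vector_mult_0_right zero_neq_one)
    hence "0 < (\<Sum>j\<in>UNIV. d j * (norm ((axis i 1 :: complex^'n) $ j))\<^sup>2)"
      using pd unfolding posdef_def inner_conjugate_diag v[symmetric] by blast
    also have "\<dots> = (\<Sum>j\<in>UNIV. if j = i then d i else 0)"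
      by (intro sum.cong) (auto simp: axis_def)
    finally show "0 < d i" by simp
  qed
next
  assume d: "\<forall>i. 0 < d i"
  have "0 < v \<bullet> ((U ** real_diag d ** ctranspose U) *v v)" if "v \<noteq> 0" for v
  proof -
    have "U *v (ctranspose U *v v) = v"
      using U by (simp add: matrix_vector_mul_assoc unitary_def)
    hence "ctranspose U *v v \<noteq> 0" using that by force
    then obtain i where "(ctranspose U *v v) $ i \<noteq> 0" by (auto simp: vec_eq_iff)
    thus ?thesis unfolding inner_conjugate_diag
      using d by (intro sum_pos2[where i = i]) (auto simp: less_imp_le)
  qed
  thus "posdef (U ** real_diag d ** ctranspose U)"
    by (simp add: posdef_def hermitian_conjugate_diag)
qed

lemma posdef_imp_hermitian: "posdef X \<Longrightarrow> hermitian X"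
  by (simp add: posdef_def)

lemma posdef_diagonalization:
  assumes "posdef X"
  obtains U d where "unitary U" "X = U ** real_diag d ** ctranspose U" "\<forall>i. 0 < d i"
proof -
  obtain U d where U: "unitary U" and X: "X = U ** real_diag d ** ctranspose U"
    using hermitian_unitary_diagonalization[OF posdef_imp_hermitian[OF assms]] .
  have "\<forall>i. 0 < d i"
    using assms unfolding X posdef_conjugate_diag_iff[OF U] .
  thus thesis using that[OF U X] by simp
qed

lemma herm_fun_cong:
  assumes "posdef X" "\<And>x. 0 < x \<Longrightarrow> f x = g x"
  shows "herm_fun f X = herm_fun g X"
proof -
  obtain U d where U: "unitary U" and X: "X = U ** real_diag d ** ctranspose U"
    and d: "\<forall>i. 0 < d i"
    using posdef_diagonalization[OF assms(1)] .
  show ?thesis unfolding X herm_fun_diag[OF U] by (simp add: assms(2) d)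
qed

lemma herm_fun_ident:
  assumes "hermitian X"
  shows "herm_fun (\<lambda>x. x) X = X"
proof -
  obtain U d where U: "unitary U" and X: "X = U ** real_diag d ** ctranspose U"
    using hermitian_unitary_diagonalization[OF assms] .
  show ?thesis unfolding X herm_fun_diag[OF U] ..
qed

lemma herm_fun_compose:
  assumes "hermitian X"
  shows "herm_fun f (herm_fun g X) = herm_fun (\<lambda>x. f (g x)) X"
proof -
  obtain U d where U: "unitary U" and X: "X = U ** real_diag d ** ctranspose U"
    using hermitian_unitary_diagonalization[OF assms] .
  show ?thesis unfolding X herm_fun_diag[OF U] ..
qed

lemma conjugate_scaleR:
  "c *\<^sub>R (U ** D ** ctranspose U) = U ** (c *\<^sub>R D) ** ctranspose (U :: complex^'n^'n)"
  by (simp add: matrix_matrix_mult_def vec_eq_iff scaleR_sum_right sum_distrib_right)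

lemma herm_fun_scaleR:
  fixes X :: "complex^'n^'n"
  assumes "hermitian X"
  shows "herm_fun (\<lambda>x. c * f x) X = c *\<^sub>R herm_fun f X"
proof -
  obtain U d where U: "unitary U" and X: "X = U ** real_diag d ** ctranspose U"
    using hermitian_unitary_diagonalization[OF assms] .
  have "real_diag (\<lambda>i. c * f (d i)) = c *\<^sub>R (real_diag (\<lambda>i. f (d i)) :: complex^'n^'n)"
    by (simp add: real_diag_def vec_eq_iff complex_eq_iff)
  thus ?thesis unfolding X herm_fun_diag[OF U] conjugate_scaleR by simp
qed

lemma posdef_herm_fun:
  assumes "posdef X" "\<And>x. 0 < x \<Longrightarrow> 0 < f x"
  shows "posdef (herm_fun f X)"
proof -
  obtain U d where U: "unitary U" and X: "X = U ** real_diag d ** ctranspose U"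
    and d: "\<forall>i. 0 < d i"
    using posdef_diagonalization[OF assms(1)] .
  show ?thesis
    unfolding X herm_fun_diag[OF U] posdef_conjugate_diag_iff[OF U] by (simp add: d assms(2))
qed

lemma matrix_inv_unique:
  fixes X Y :: "'a::field^'n^'n"
  assumes "X ** Y = mat 1"
  shows "matrix_inv X = Y"
proof -
  have YX: "Y ** X = mat 1" using assms matrix_left_right_inverse by blast
  have "X ** matrix_inv X = mat 1 \<and> matrix_inv X ** X = mat 1"
    unfolding matrix_inv_def by (rule someI[of _ Y]) (simp add: assms YX)
  thus ?thesis by (metis YX matrix_mul_assoc matrix_mul_lid matrix_mul_rid)
qed

lemma real_diag_mult: "real_diag a ** real_diag b = real_diag (\<lambda>i. a i * b i)"
  by (simp add: vec_eq_iff real_diag_mult_left) (simp add: real_diag_def)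

lemma real_diag_one: "real_diag (\<lambda>_. 1) = mat 1"
  by (simp add: real_diag_def mat_def vec_eq_iff)

lemma conjugate_mult_conjugate:
  assumes "unitary U"
  shows "(U ** C ** ctranspose U) ** (U ** D ** ctranspose U) = U ** (C ** D) ** ctranspose U"
  using assms by (simp add: unitary_def matrix_mul_assoc[symmetric])
    (simp add: matrix_mul_assoc)

lemma matrix_inv_posdef:
  assumes "posdef X"
  shows "matrix_inv X = herm_fun inverse X"
proof -
  obtain U d where U: "unitary U" and X: "X = U ** real_diag d ** ctranspose U"
    and d: "\<forall>i. 0 < d i"
    using posdef_diagonalization[OF assms] .
  have "d i * inverse (d i) = 1" for i using d by (simp add: less_imp_neq[THEN not_sym])
  hence "X ** herm_fun inverse X = U ** mat 1 ** ctranspose U"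
    unfolding X herm_fun_diag[OF U] conjugate_mult_conjugate[OF U] real_diag_mult
    by (simp add: real_diag_one)
  also have "\<dots> = mat 1" using U by (simp add: unitary_def)
  finally show ?thesis by (rule matrix_inv_unique)
qed

lemma map_matrix_cnj_mult: "map_matrix cnj (X ** Y) = map_matrix cnj X ** map_matrix cnj Y"
  by (simp add: matrix_matrix_mult_def vec_eq_iff)

lemma map_matrix_cnj_ctranspose: "map_matrix cnj (ctranspose Y) = ctranspose (map_matrix cnj Y)"
  by (simp add: ctranspose_def vec_eq_iff)

lemma map_matrix_cnj_mat_1: "map_matrix cnj (mat 1) = mat 1"
  by (simp add: vec_eq_iff mat_def)

lemma herm_fun_cnj:
  fixes X :: "complex^'n^'n"
  assumes "hermitian X"
  shows "herm_fun f (map_matrix cnj X) = map_matrix cnj (herm_fun f X)"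
proof -
  obtain U d where U: "unitary U" and X: "X = U ** real_diag d ** ctranspose U"
    using hermitian_unitary_diagonalization[OF assms] .
  have cU: "unitary (map_matrix cnj U)"
    using U unfolding unitary_def map_matrix_cnj_ctranspose[symmetric] map_matrix_cnj_mult[symmetric]
    by (simp add: map_matrix_cnj_mat_1)
  have conj: "map_matrix cnj (U ** real_diag e ** ctranspose U)
      = map_matrix cnj U ** real_diag e ** ctranspose (map_matrix cnj U)" for e
    unfolding map_matrix_cnj_mult map_matrix_cnj_ctranspose
    by (rule arg_cong[where f = "\<lambda>D. _ ** D ** _"]) (simp add: real_diag_def vec_eq_iff)
  show ?thesis unfolding X conj herm_fun_diag[OF U] herm_fun_diag[OF cU] ..
qed

lemma norm_unitary:
  fixes U :: "complex^'n^'n"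
  assumes "unitary U"
  shows "norm U = sqrt (real CARD('n))"
proof -
  have "norm (U $ i) = 1" for i
  proof -
    have "1 = Re ((U ** ctranspose U) $ i $ i)"
      using assms by (simp add: unitary_def mat_def)
    also have "\<dots> = U $ i \<bullet> U $ i"
      by (simp add: matrix_matrix_mult_def ctranspose_def inner_vec_def inner_complex_def)
    finally show ?thesis by (simp add: norm_eq_1)
  qed
  thus ?thesis by (simp add: norm_vec_def[of U] L2_set_def)
qed

text \<open>Eigenvectors do not depend continuously on the matrix, but the unitary group is compact: along a
  subsequence the diagonalising unitaries converge, the diagonal factors converge with them, and
  the limits diagonalise \<open>L\<close>. Positivity of \<open>L\<close> puts the limit eigenvalues where \<open>f\<close> is continuous.\<close>

lemma herm_fun_subseq_tendsto:
  fixes X :: "nat \<Rightarrow> complex^'n^'n"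
  assumes lim: "X \<longlonglongrightarrow> L" and herm: "\<And>n. hermitian (X n)" and L: "posdef L"
    and f: "continuous_on {0<..} f"
  shows "\<exists>r. strict_mono r \<and> (\<lambda>n. herm_fun f (X (r n))) \<longlonglongrightarrow> herm_fun f L"
proof -
  have "\<exists>U d. unitary U \<and> X n = U ** real_diag d ** ctranspose U" for n
    by (rule hermitian_unitary_diagonalization[OF herm[of n]]) blast
  then obtain U d where U: "\<And>n. unitary (U n)"
    and X: "\<And>n. X n = U n ** real_diag (d n) ** ctranspose (U n)"
    by metis
  have "bounded (range U)"
    unfolding bounded_iff using norm_unitary[OF U] by auto
  then obtain V r where r: "strict_mono r" and "(U \<circ> r) \<longlonglongrightarrow> V"
    using bounded_imp_convergent_subsequence by blast
  hence V: "(\<lambda>n. U (r n)) \<longlonglongrightarrow> V" by (simp add: o_def)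
  have Xr: "(\<lambda>n. X (r n)) \<longlonglongrightarrow> L"
    using LIMSEQ_subseq_LIMSEQ[OF lim r] by (simp add: o_def)
  have "(\<lambda>n. ctranspose (U (r n)) ** U (r n)) \<longlonglongrightarrow> ctranspose V ** V"
    "(\<lambda>n. U (r n) ** ctranspose (U (r n))) \<longlonglongrightarrow> V ** ctranspose V"
    by (intro tendsto_intros V)+
  hence V_unitary: "unitary V"
    using U by (simp add: unitary_def LIMSEQ_const_iff)
  \<comment> \<open>The limit of the diagonal factors: the eigenvalues are entries of a convergent product of
    matrices, hence converge themselves.\<close>
  define D where "D = ctranspose V ** L ** V"
  have "ctranspose (U n) ** X n ** U n = real_diag (d n)" for n
    using U[of n] unfolding X by (simp add: unitary_def matrix_mul_assoc)
      (simp add: matrix_mul_assoc[symmetric])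
  moreover have "(\<lambda>n. ctranspose (U (r n)) ** X (r n) ** U (r n)) \<longlonglongrightarrow> D"
    unfolding D_def by (intro tendsto_intros V Xr)
  ultimately have "(\<lambda>n. real_diag (d (r n))) \<longlonglongrightarrow> D" by simp
  hence lim_ent: "(\<lambda>n. real_diag (d (r n)) $ i $ j) \<longlonglongrightarrow> D $ i $ j" for i j
    by (intro tendsto_vec_nth)
  define e where "e i = Re (D $ i $ i)" for i
  have d_lim: "(\<lambda>n. d (r n) i) \<longlonglongrightarrow> e i" for i
    using tendsto_Re[OF lim_ent[of i i]] by (simp add: real_diag_def e_def)
  have "D $ i $ j = real_diag e $ i $ j" for i j
  proof (cases "i = j")
    case True
    have "(\<lambda>n. complex_of_real (d (r n) i)) \<longlonglongrightarrow> of_real (e i)"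
      by (intro tendsto_of_real d_lim)
    thus ?thesis using LIMSEQ_unique[OF lim_ent[of i i]] True by (simp add: real_diag_def)
  next
    case False
    thus ?thesis using lim_ent[of i j] by (simp add: real_diag_def LIMSEQ_const_iff)
  qed
  hence "D = real_diag e" by (simp add: vec_eq_iff)
  hence L_eq: "L = V ** real_diag e ** ctranspose V"
    using V_unitary unfolding D_def
    by (metis matrix_mul_assoc matrix_mul_lid matrix_mul_rid unitary_def)
  have "0 < e i" for i
    using L V_unitary posdef_conjugate_diag_iff unfolding L_eq by blast
  hence "isCont f (e i)" for i
    using f by (simp add: continuous_on_eq_continuous_at)
  hence "(\<lambda>n. f (d (r n) i)) \<longlonglongrightarrow> f (e i)" for i
    using d_lim isCont_tendsto_compose by blast
  hence "(\<lambda>n. real_diag (\<lambda>i. f (d (r n) i))) \<longlonglongrightarrow> (real_diag (\<lambda>i. f (e i)) :: complex^'n^'n)"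
    unfolding real_diag_def by (intro tendsto_vec_lambda) (auto intro: tendsto_of_real)
  hence "(\<lambda>n. herm_fun f (X (r n))) \<longlonglongrightarrow> herm_fun f L"
    unfolding X L_eq herm_fun_diag[OF U] herm_fun_diag[OF V_unitary] by (intro tendsto_intros V)
  thus ?thesis using r by blast
qed

text \<open>The limit in \<open>herm_fun_subseq_tendsto\<close> is the same for every subsequence, so the whole sequence
  converges.\<close>

lemma tendsto_herm_fun:
  fixes X :: "nat \<Rightarrow> complex^'n^'n"
  assumes lim: "X \<longlonglongrightarrow> L" and herm: "\<And>n. hermitian (X n)" and L: "posdef L"
    and f: "continuous_on {0<..} f"
  shows "(\<lambda>n. herm_fun f (X n)) \<longlonglongrightarrow> herm_fun f L"
proof (rule ccontr)
  assume "\<not> ?thesis"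
  then obtain e where e: "e > 0"
    and "\<not> (\<forall>\<^sub>F n in sequentially. dist (herm_fun f (X n)) (herm_fun f L) < e)"
    by (auto simp: tendsto_iff)
  hence "\<exists>\<^sub>\<infinity>n. \<not> dist (herm_fun f (X n)) (herm_fun f L) < e"
    by (simp add: not_eventually cofinite_eq_sequentially)
  hence "infinite {n. \<not> dist (herm_fun f (X n)) (herm_fun f L) < e}"
    by (simp add: INFM_iff_infinite)
  then obtain s :: "nat \<Rightarrow> nat" where s: "strict_mono s"
    and far: "\<And>n. \<not> dist (herm_fun f (X (s n))) (herm_fun f L) < e"
    using infinite_enumerate by blast
  have "(\<lambda>n. X (s n)) \<longlonglongrightarrow> L"
    using LIMSEQ_subseq_LIMSEQ[OF lim s] by (simp add: o_def)
  then obtain r where "(\<lambda>n. herm_fun f (X (s (r n)))) \<longlonglongrightarrow> herm_fun f L"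
    using herm_fun_subseq_tendsto[of "\<lambda>n. X (s n)", OF _ herm L f] by blast
  hence "\<forall>\<^sub>F n in sequentially. dist (herm_fun f (X (s (r n)))) (herm_fun f L) < e"
    using e by (simp add: tendsto_iff)
  hence "\<forall>\<^sub>F n :: nat in sequentially. False" using far by simp
  thus False by simp
qed

lemma continuous_on_herm_fun:
  fixes F :: "'a::{first_countable_topology, t2_space} \<Rightarrow> complex^'n^'n"
  assumes F: "continuous_on S F" and pd: "\<And>z. z \<in> S \<Longrightarrow> posdef (F z)"
    and f: "continuous_on {0<..} f"
  shows "continuous_on S (\<lambda>z. herm_fun f (F z))"
proof (rule continuous_on_sequentiallyI)
  fix u a assume u: "\<forall>n. u n \<in> S" "a \<in> S" "u \<longlonglongrightarrow> a"
  hence "(\<lambda>n. F (u n)) \<longlonglongrightarrow> F a"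
    using F by (auto simp: continuous_on_sequentially o_def)
  thus "(\<lambda>n. herm_fun f (F (u n))) \<longlonglongrightarrow> herm_fun f (F a)"
    using u pd by (intro tendsto_herm_fun f) (auto intro: posdef_imp_hermitian)
qed

section \<open>Strict convexity of trace functions\<close>

lemma Re_trace_conjugate_diag_mult:
  fixes U V :: "complex^'n^'n"
  shows "Re (trace ((U ** real_diag a ** ctranspose U) ** (V ** real_diag b ** ctranspose V)))
     = (\<Sum>j\<in>UNIV. \<Sum>i\<in>UNIV. (cmod ((ctranspose V ** U) $ j $ i))\<^sup>2 * (a i * b j))"
proof -
  define W where "W = ctranspose V ** U"
  have W': "ctranspose W = ctranspose U ** V"
    by (simp add: W_def ctranspose_mult ctranspose_ctranspose)
  have "trace ((U ** real_diag a ** ctranspose U) ** (V ** real_diag b ** ctranspose V))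
      = trace (((U ** real_diag a ** ctranspose U) ** (V ** real_diag b)) ** ctranspose V)"
    by (simp add: matrix_mul_assoc)
  also have "\<dots> = trace (ctranspose V ** ((U ** real_diag a ** ctranspose U) ** (V ** real_diag b)))"
    by (rule trace_mul_sym)
  also have "\<dots> = trace (((W ** real_diag a) ** ctranspose W) ** real_diag b)"
    unfolding W' unfolding W_def by (simp add: matrix_mul_assoc)
  also have "Re \<dots> = (\<Sum>j\<in>UNIV. Re (((W ** real_diag a) ** ctranspose W) $ j $ j) * b j)"
    by (simp add: trace_def real_diag_mult_right)
  also have "\<dots> = (\<Sum>j\<in>UNIV. (\<Sum>i\<in>UNIV. (cmod (W $ j $ i))\<^sup>2 * a i) * b j)"
  proof (intro sum.cong refl arg_cong2[where f = "(*)"])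
    fix j
    have "((W ** real_diag a) ** ctranspose W) $ j $ j
        = (\<Sum>i\<in>UNIV. W $ j $ i * of_real (a i) * cnj (W $ j $ i))"
      unfolding matrix_matrix_mult_def[of "W ** real_diag a"]
      by (simp add: real_diag_mult_right ctranspose_def)
    thus "Re (((W ** real_diag a) ** ctranspose W) $ j $ j) = (\<Sum>i\<in>UNIV. (cmod (W $ j $ i))\<^sup>2 * a i)"
      by (simp add: cmod_power2 algebra_simps) (simp add: power2_eq_square algebra_simps)
  qed
  finally show ?thesis
    by (simp add: W_def sum_distrib_right mult.assoc)
qed

lemma matrix_diff_mult: "(X - Y) ** Z = X ** Z - Y ** (Z :: complex^'k^'n)"
  by (simp add: matrix_matrix_mult_def vec_eq_iff algebra_simps sum_subtractf)

text \<open>Klein's inequality. In the eigenbases of \<open>P\<close> and \<open>Q\<close> the difference of the two sides is a sum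
  of scalar tangent gaps \<open>f (p i) - f (q j) - (p i - q j) * g (q j)\<close>, weighted by the squared overlaps
  of the eigenvectors. If it vanishes, only equal eigenvalues overlap, and then \<open>P = Q\<close>. The tangent
  condition says that \<open>f\<close> is strictly convex with slope \<open>g\<close>.\<close>

lemma klein_inequality:
  fixes P Q :: "complex^'n^'n" and f g :: "real \<Rightarrow> real"
  assumes P: "posdef P" and Q: "posdef Q"
    and tangent: "\<And>x y. 0 < x \<Longrightarrow> 0 < y \<Longrightarrow> x \<noteq> y \<Longrightarrow> f y + (x - y) * g y < f x"
  shows "Re (trace (herm_fun f Q)) + Re (trace ((P - Q) ** herm_fun g Q)) \<le> Re (trace (herm_fun f P))"
      (is "?L \<le> ?R")
    and "Re (trace (herm_fun f Q)) + Re (trace ((P - Q) ** herm_fun g Q)) = Re (trace (herm_fun f P))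
      \<Longrightarrow> P = Q"
proof -
  obtain U p where U: "unitary U" and P_eq: "P = U ** real_diag p ** ctranspose U"
    and p: "\<forall>i. 0 < p i"
    using posdef_diagonalization[OF P] .
  obtain V q where V: "unitary V" and Q_eq: "Q = V ** real_diag q ** ctranspose V"
    and q: "\<forall>i. 0 < q i"
    using posdef_diagonalization[OF Q] .
  define W where "W = ctranspose V ** U"
  define T where "T a b = (\<Sum>j\<in>UNIV. \<Sum>i\<in>UNIV. (cmod (W $ j $ i))\<^sup>2 * (a i * b j))"
    for a b :: "'n \<Rightarrow> real"
  have T: "Re (trace ((U ** real_diag a ** ctranspose U) ** (V ** real_diag b ** ctranspose V))) = T a b"
    for a b unfolding T_def W_def by (rule Re_trace_conjugate_diag_mult)
  have oneU: "mat 1 = U ** real_diag (\<lambda>_. 1) ** ctranspose U"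
    and oneV: "mat 1 = V ** real_diag (\<lambda>_. 1) ** ctranspose V"
    using U V by (simp_all add: real_diag_one unitary_def)
  have fP: "Re (trace (herm_fun f P)) = T (\<lambda>i. f (p i)) (\<lambda>_. 1)"
    unfolding P_eq herm_fun_diag[OF U] T[symmetric] oneV[symmetric] by simp
  have fQ: "Re (trace (herm_fun f Q)) = T (\<lambda>_. 1) (\<lambda>j. f (q j))"
    unfolding Q_eq herm_fun_diag[OF V] T[symmetric] oneU[symmetric] by simp
  have PgQ: "Re (trace (P ** herm_fun g Q)) = T p (\<lambda>j. g (q j))"
    unfolding P_eq Q_eq herm_fun_diag[OF V] T ..
  have "Q ** herm_fun g Q = V ** real_diag (\<lambda>j. q j * g (q j)) ** ctranspose V"
    unfolding Q_eq herm_fun_diag[OF V] conjugate_mult_conjugate[OF V] real_diag_mult ..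
  hence QgQ: "Re (trace (Q ** herm_fun g Q)) = T (\<lambda>_. 1) (\<lambda>j. q j * g (q j))"
    unfolding T[symmetric] oneU[symmetric] by simp
  define gap where "gap i j = f (p i) - f (q j) - (p i - q j) * g (q j)" for i j
  have gap_pos: "gap i j > 0" if "p i \<noteq> q j" for i j
    using tangent[of "p i" "q j"] p q that by (simp add: gap_def)
  have gap_nonneg: "gap i j \<ge> 0" for i j
    using gap_pos[of i j] by (cases "p i = q j") (auto simp: gap_def)
  have diff: "?R - ?L = (\<Sum>j\<in>UNIV. \<Sum>i\<in>UNIV. (cmod (W $ j $ i))\<^sup>2 * gap i j)"
    unfolding matrix_diff_mult trace_sub minus_complex.sel fP fQ PgQ QgQ
    by (simp add: T_def gap_def algebra_simps sum.distrib sum_subtractf)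
  show "?L \<le> ?R"
  proof -
    have "0 \<le> ?R - ?L"
      unfolding diff by (intro sum_nonneg mult_nonneg_nonneg gap_nonneg) auto
    thus ?thesis by simp
  qed
  assume "?L = ?R"
  hence "(\<Sum>j\<in>UNIV. \<Sum>i\<in>UNIV. (cmod (W $ j $ i))\<^sup>2 * gap i j) = 0"
    unfolding diff[symmetric] by simp
  hence zero: "(cmod (W $ j $ i))\<^sup>2 * gap i j = 0" for i j
    using gap_nonneg by (simp add: sum_nonneg_eq_0_iff sum_nonneg)
  have "W $ j $ i = 0 \<or> p i = q j" for i j
    using zero[of j i] gap_pos[of i j] by fastforce
  hence "W ** real_diag p = real_diag q ** W"
    unfolding vec_eq_iff real_diag_mult_left real_diag_mult_right
    by (metis mult.commute mult_zero_left)
  hence "V ** (W ** real_diag p) ** ctranspose U = V ** (real_diag q ** W) ** ctranspose U"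
    by simp
  moreover have "V ** (W ** real_diag p) ** ctranspose U = P"
    using V by (simp add: P_eq W_def matrix_mul_assoc unitary_def)
  moreover have "V ** (real_diag q ** W) ** ctranspose U = Q"
    using U by (simp add: Q_eq W_def matrix_mul_assoc[symmetric] unitary_def)
  ultimately show "P = Q" by simp
qed

lemma posdef_midpoint:
  assumes "posdef P" "posdef Q"
  shows "posdef ((1/2) *\<^sub>R (P + Q))"
proof -
  have "((1/2) *\<^sub>R (P + Q)) *v v = (1/2) *\<^sub>R (P *v v + Q *v v)" for v
    by (simp add: matrix_vector_mult_def vec_eq_iff scaleR_sum_right algebra_simps sum.distrib)
  thus ?thesis using assms
    by (simp add: posdef_def hermitian_def ctranspose_simps inner_add_right add_pos_pos)
qed

text \<open>Klein's inequality at the midpoint \<open>M\<close>, once for \<open>P\<close> and once for \<open>Q\<close>: since \<open>P - M\<close> and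
  \<open>Q - M\<close> are opposite, the first-order terms cancel in the sum.\<close>

lemma trace_herm_fun_midpoint:
  fixes P Q :: "complex^'n^'n" and f g :: "real \<Rightarrow> real"
  assumes P: "posdef P" and Q: "posdef Q"
    and tangent: "\<And>x y. 0 < x \<Longrightarrow> 0 < y \<Longrightarrow> x \<noteq> y \<Longrightarrow> f y + (x - y) * g y < f x"
  shows "2 * Re (trace (herm_fun f ((1/2) *\<^sub>R (P + Q))))
           \<le> Re (trace (herm_fun f P)) + Re (trace (herm_fun f Q))" (is "2 * ?M \<le> ?S")
    and "2 * Re (trace (herm_fun f ((1/2) *\<^sub>R (P + Q))))
           = Re (trace (herm_fun f P)) + Re (trace (herm_fun f Q)) \<Longrightarrow> P = Q"
proof -
  define M where "M = (1/2) *\<^sub>R (P + Q)"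
  have M: "posdef M" unfolding M_def using P Q by (rule posdef_midpoint)
  have "M + M = P + Q" by (simp add: M_def flip: scaleR_left_distrib)
  hence QM: "Q - M = - (P - M)" by (simp add: algebra_simps)
  have neg_mult: "(- X) ** Y = - (X ** Y)" for X Y :: "complex^'n^'n"
    by (simp add: matrix_matrix_mult_def vec_eq_iff sum_negf)
  have neg_trace: "trace (- X) = - trace X" for X :: "complex^'n^'n"
    by (simp add: trace_def sum_negf)
  have opp: "Re (trace ((Q - M) ** herm_fun g M)) = - Re (trace ((P - M) ** herm_fun g M))"
    unfolding QM neg_mult neg_trace by simp
  note kP = klein_inequality[OF P M tangent] and kQ = klein_inequality[OF Q M tangent]
  show "2 * ?M \<le> ?S"
    using kP(1) kQ(1) opp unfolding M_def[symmetric] by linarith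
  assume "2 * ?M = ?S"
  hence "P = M" "Q = M"
    using kP kQ opp unfolding M_def[symmetric] by (smt (verit))+
  thus "P = Q" by simp
qed

lemma strict_tangent_of_strict_mono_deriv:
  fixes f g :: "real \<Rightarrow> real"
  assumes deriv: "\<And>x. 0 < x \<Longrightarrow> (f has_real_derivative g x) (at x)"
    and mono: "\<And>x y. 0 < x \<Longrightarrow> x < y \<Longrightarrow> g x < g y"
    and xy: "0 < x" "0 < y" "x \<noteq> y"
  shows "f y + (x - y) * g y < f x"
proof (cases "x < y")
  case True
  then obtain z where z: "x < z" "z < y" "f y - f x = (y - x) * g z"
    using MVT2[of x y f g] deriv xy by force
  have "(y - x) * g z < (y - x) * g y"
    using z xy mono[of z y] True by (intro mult_strict_left_mono) auto
  thus ?thesis using z by (simp add: algebra_simps)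
next
  case False
  then obtain z where z: "y < z" "z < x" "f x - f y = (x - y) * g z"
    using MVT2[of y x f g] deriv xy by force
  have "(x - y) * g y < (x - y) * g z"
    using z xy mono[of y z] False by (intro mult_strict_left_mono) auto
  thus ?thesis using z by (simp add: algebra_simps)
qed

section \<open>Coercivity and integration on the circle\<close>

lemma mat_of_real_mult_vector: "mat (of_real k) *v v = k *\<^sub>R (v :: complex^'n)"
  by (simp add: matrix_vector_mult_def mat_def vec_eq_iff scaleR_conv_of_real[where 'a = complex]
      if_distrib[where f = "\<lambda>x. x * _"] cong: if_cong)

text \<open>The quadratic form attains its extrema on the compact product of the unit circle and the unit
  sphere, and the minimum is positive by pointwise definiteness.\<close>

lemma posdef_coercive_on_circle:
  fixes F :: "complex \<Rightarrow> complex^'n^'n"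
  assumes F: "continuous_on (sphere 0 1) F" and pd: "\<And>z. z \<in> sphere 0 1 \<Longrightarrow> posdef (F z)"
  shows "\<exists>k1 k2 :: real. 0 < k1 \<and> 0 < k2 \<and>
    (\<forall>z\<in>sphere 0 1. psd (F z - mat (of_real k1)) \<and> psd (mat (of_real k2) - F z))"
proof -
  define K :: "(complex \<times> (complex^'n)) set" where "K = sphere 0 1 \<times> sphere 0 1"
  define q where "q x = snd x \<bullet> (F (fst x) *v snd x)" for x
  have K: "compact K" "K \<noteq> {}"
    by (auto simp: K_def intro!: compact_Times)
  have "continuous_on K (\<lambda>x. F (fst x))"
    by (rule continuous_on_compose2[OF F]) (auto simp: K_def intro!: continuous_intros)
  hence q: "continuous_on K q"
    unfolding q_def by (intro continuous_intros)
  obtain a where a: "a \<in> K" "\<forall>x\<in>K. q a \<le> q x" using continuous_attains_inf[OF K q] by blast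
  obtain b where b: "b \<in> K" "\<forall>x\<in>K. q x \<le> q b" using continuous_attains_sup[OF K q] by blast
  have "fst a \<in> sphere 0 1" "snd a \<noteq> 0" using a(1) by (auto simp: K_def)
  hence "0 < q a" using pd unfolding q_def posdef_def by blast
  hence "0 < q b" using a(1) b(2) by fastforce
  have quad: "q a * (v \<bullet> v) \<le> v \<bullet> (F z *v v)" "v \<bullet> (F z *v v) \<le> q b * (v \<bullet> v)"
    if z: "z \<in> sphere 0 1" for z v
  proof -
    show "q a * (v \<bullet> v) \<le> v \<bullet> (F z *v v)"
    proof (cases "v = 0")
      case False
      have "(z, (1 / norm v) *\<^sub>R v) \<in> K" using z False by (simp add: K_def dist_norm)
      hence "q a \<le> q (z, (1 / norm v) *\<^sub>R v)" using a(2) by blast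
      thus ?thesis using False
        by (simp add: q_def matrix_vector_scaleR field_simps flip: power2_norm_eq_inner)
          (simp add: power2_eq_square mult.assoc)
    qed simp
    show "v \<bullet> (F z *v v) \<le> q b * (v \<bullet> v)"
    proof (cases "v = 0")
      case False
      have "(z, (1 / norm v) *\<^sub>R v) \<in> K" using z False by (simp add: K_def dist_norm)
      hence "q (z, (1 / norm v) *\<^sub>R v) \<le> q b" using b(2) by blast
      thus ?thesis using False
        by (simp add: q_def matrix_vector_scaleR field_simps flip: power2_norm_eq_inner)
          (simp add: power2_eq_square mult.assoc)
    qed simp
  qed
  have "psd (F z - mat (of_real (q a))) \<and> psd (mat (of_real (q b)) - F z)" if "z \<in> sphere 0 1" for z
    using pd[OF that] quad[OF that]
    by (simp add: psd_def posdef_def hermitian_def ctranspose_simps matrix_vector_mult_diff_rdistrib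
        inner_diff_right mat_of_real_mult_vector)
  thus ?thesis using \<open>0 < q a\<close> \<open>0 < q b\<close> by blast
qed

lemma posdef_imp_psd: "posdef X \<Longrightarrow> psd X"
  unfolding posdef_def psd_def by (metis inner_zero_left less_eq_real_def)

lemma continuous_on_cis: "continuous_on S F \<Longrightarrow> (\<And>\<theta>. \<theta> \<in> T \<Longrightarrow> cis \<theta> \<in> S) \<Longrightarrow> continuous_on T (\<lambda>\<theta>. F (cis \<theta>))"
  by (rule continuous_on_compose2[of S F]) (auto intro!: continuous_intros simp: cis_conv_exp)

lemma set_integrable_circle:
  fixes F :: "complex \<Rightarrow> 'a::{banach, second_countable_topology}"
  assumes "continuous_on (sphere 0 1) F"
  shows "set_integrable lborel {-pi..pi} (\<lambda>\<theta>. F (cis \<theta>))"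
  by (intro borel_integrable_atLeastAtMost' continuous_on_cis[OF assms]) auto

lemma circle_integral_add:
  fixes F G :: "complex \<Rightarrow> 'a::{banach, second_countable_topology}"
  assumes "continuous_on (sphere 0 1) F" "continuous_on (sphere 0 1) G"
  shows "circle_integral (\<lambda>z. F z + G z) = circle_integral F + circle_integral G"
  unfolding circle_integral_def
  using assms[THEN set_integrable_circle] by (simp add: scaleR_right_distrib)

lemma circle_integral_bounded_linear:
  fixes F :: "complex \<Rightarrow> 'a::{banach, second_countable_topology}"
    and T :: "'a \<Rightarrow> 'b::{banach, second_countable_topology}"
  assumes T: "bounded_linear T" and F: "continuous_on (sphere 0 1) F"
  shows "circle_integral (\<lambda>z. T (F z)) = T (circle_integral F)"
proof -
  interpret T: bounded_linear T by (rule T)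
  have "(LINT \<theta>:{-pi..pi}|lborel. T (F (cis \<theta>))) = T (LINT \<theta>:{-pi..pi}|lborel. F (cis \<theta>))"
    unfolding set_lebesgue_integral_def T.scaleR[symmetric]
    using set_integrable_circle[OF F] unfolding set_integrable_def
    by (rule integral_bounded_linear[OF T])
  thus ?thesis by (simp add: circle_integral_def T.scaleR)
qed

lemma circle_integral_cong:
  assumes "\<And>z. z \<in> sphere 0 1 \<Longrightarrow> F z = G z"
  shows "circle_integral F = circle_integral G"
proof -
  have "F (cis \<theta>) = G (cis \<theta>)" for \<theta> by (rule assms) simp
  thus ?thesis by (simp add: circle_integral_def)
qed

lemma circle_integral_nonneg:
  fixes F :: "complex \<Rightarrow> real"
  assumes "\<And>z. z \<in> sphere 0 1 \<Longrightarrow> 0 \<le> F z"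
  shows "0 \<le> circle_integral F"
proof -
  have "0 \<le> F (cis \<theta>)" for \<theta> by (rule assms) simp
  thus ?thesis unfolding circle_integral_def set_lebesgue_integral_def
    by (intro scaleR_nonneg_nonneg integral_nonneg_AE) auto
qed

text \<open>This turns equality of integrals back into equality at every point of the circle, not only almost
  everywhere.\<close>

lemma circle_integral_eq_0_imp:
  fixes F :: "complex \<Rightarrow> real"
  assumes F: "continuous_on (sphere 0 1) F" and nn: "\<And>z. z \<in> sphere 0 1 \<Longrightarrow> 0 \<le> F z"
    and zero: "circle_integral F = 0" and z: "z \<in> sphere 0 1"
  shows "F z = 0"
proof -
  have "(LINT \<theta>:{-pi..pi}|lborel. F (cis \<theta>)) = integral {-pi..pi} (\<lambda>\<theta>. F (cis \<theta>))"
    by (rule set_borel_integral_eq_integral(2)[OF set_integrable_circle[OF F]])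
  hence "integral {-pi..pi} (\<lambda>\<theta>. F (cis \<theta>)) = 0"
    using zero by (simp add: circle_integral_def)
  moreover have "continuous_on {-pi..pi} (\<lambda>\<theta>. F (cis \<theta>))"
    by (rule continuous_on_cis[OF F]) auto
  ultimately have "\<forall>\<theta>\<in>{-pi..pi}. F (cis \<theta>) = 0"
    using nn by (subst (asm) integral_eq_0_iff) auto
  moreover have "z \<noteq> 0" using z by auto
  hence "cis (Arg z) = z" "Arg z \<in> {-pi..pi}"
    using z Arg_bounded[of z] by (simp_all add: cis_Arg sgn_eq)
  ultimately show ?thesis by metis
qed

lemma circle_integral_Re_trace:
  fixes F :: "complex \<Rightarrow> complex^'n^'n"
  assumes "continuous_on (sphere 0 1) F"
  shows "Re (trace (circle_integral F)) = circle_integral (\<lambda>z. Re (trace (F z)))"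
proof -
  have "linear (\<lambda>X :: complex^'n^'n. Re (trace X))"
    by (rule linearI) (simp_all add: trace_def sum.distrib sum_distrib_left)
  hence "bounded_linear (\<lambda>X :: complex^'n^'n. Re (trace X))"
    by (simp add: linear_conv_bounded_linear)
  from circle_integral_bounded_linear[OF this assms] show ?thesis by simp
qed

section \<open>The transfer function and spectral densities on the circle\<close>

lemma continuous_on_det [continuous_intros]:
  fixes F :: "'a::topological_space \<Rightarrow> complex^'n^'n"
  shows "continuous_on S F \<Longrightarrow> continuous_on S (\<lambda>x. det (F x))"
  unfolding det_def by (intro continuous_intros)

text \<open>Cramer's rule exhibits the entries of the inverse as quotients of determinants, which makes their
  continuity evident.\<close>

lemma matrix_inv_cramer:
  fixes X :: "'a::field^'n^'n"
  assumes "invertible X"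
  shows "matrix_inv X = (\<chi> k j. det (\<chi> i l. if l = k then axis j 1 $ i else X $ i $ l) / det X)"
proof -
  define Y where "Y = (\<chi> k j. det (\<chi> i l. if l = k then axis j 1 $ i else X $ i $ l) / det X)"
  have d: "det X \<noteq> 0" using assms by (simp add: invertible_det_nz)
  have "X *v column j Y = axis j 1" for j
    unfolding cramer[OF d] by (simp add: Y_def column_def)
  hence "(X ** Y) $ i $ j = axis j 1 $ i" for i j
    by (simp add: matrix_matrix_mult_def matrix_vector_mult_def column_def vec_eq_iff)
  hence "X ** Y = mat 1" by (simp add: vec_eq_iff mat_def axis_def)
  thus ?thesis unfolding Y_def by (rule matrix_inv_unique)
qed

lemma continuous_on_matrix_inv:
  fixes F :: "'a::topological_space \<Rightarrow> complex^'n^'n"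
  assumes F: "continuous_on S F" and inv: "\<And>x. x \<in> S \<Longrightarrow> invertible (F x)"
  shows "continuous_on S (\<lambda>x. matrix_inv (F x))"
proof -
  have "continuous_on S (\<lambda>x. if l = k then c else F x $ i $ l)" for i k l and c :: complex
    using F by (cases "l = k") (auto intro: continuous_intros)
  hence "continuous_on S (\<lambda>x. \<chi> k j. det (\<chi> i l. if l = k then axis j 1 $ i else F x $ i $ l) / det (F x))"
    using inv by (intro continuous_intros F) (auto simp: invertible_det_nz)
  thus ?thesis
    by (rule continuous_on_cong[THEN iffD1, rotated 2]) (auto simp: matrix_inv_cramer inv)
qed

lemma invertible_resolvent:
  assumes A: "schur_stable A" and z: "z \<in> sphere 0 1"
  shows "invertible (mat z - map_matrix of_real A :: complex^'n^'n)"
proof -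
  have "v = 0" if "(mat z - map_matrix of_real A) *v v = 0" for v :: "complex^'n"
  proof (rule ccontr)
    assume "v \<noteq> 0"
    have "mat z *v v = z *s v"
      by (simp add: matrix_vector_mult_def mat_def vec_eq_iff if_distrib[where f = "\<lambda>x. x * _"] cong: if_cong)
    hence "map_matrix of_real A *v v = z *s v"
      using that by (simp add: matrix_vector_mult_diff_rdistrib)
    hence "norm z < 1" using A \<open>v \<noteq> 0\<close> unfolding schur_stable_def by blast
    thus False using z by simp
  qed
  thus ?thesis
    using matrix_left_invertible_ker invertible_left_inverse by blast
qed

lemma continuous_on_Gtf:
  fixes A :: "real^'n^'n" and B :: "real^'m^'n"
  assumes "schur_stable A"
  shows "continuous_on (sphere 0 1) (Gtf A B)"
proof -
  have "continuous_on (sphere 0 1) (\<lambda>z. if i = j then z else 0 :: complex)" for i j :: 'n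
    by (cases "i = j") auto
  hence "continuous_on (sphere 0 1) (\<lambda>z. mat z :: complex^'n^'n)"
    unfolding mat_def by (intro continuous_on_vec_lambda)
  thus ?thesis
    unfolding Gtf_def
    by (intro continuous_intros continuous_on_matrix_inv invertible_resolvent assms)
qed

lemma continuous_on_GTG:
  "schur_stable A \<Longrightarrow> continuous_on (sphere 0 1) (GTG A B \<Theta>)"
  unfolding GTG_def by (intro continuous_intros continuous_on_Gtf)

lemma Gtf_cnj:
  fixes A :: "real^'n^'n" and B :: "real^'m^'n"
  assumes A: "schur_stable A" and z: "z \<in> sphere 0 1"
  shows "Gtf A B (cnj z) = map_matrix cnj (Gtf A B z)"
proof -
  define R where "R = (mat z - map_matrix of_real A :: complex^'n^'n)"
  have "R ** matrix_inv R = mat 1"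
    using invertible_resolvent[OF A z] unfolding R_def[symmetric] invertible_def matrix_inv_def
    by (metis (mono_tags, lifting) someI_ex)
  hence "map_matrix cnj R ** map_matrix cnj (matrix_inv R) = map_matrix cnj (mat 1)"
    by (simp flip: map_matrix_cnj_mult)
  also note map_matrix_cnj_mat_1
  finally have inv: "matrix_inv (map_matrix cnj R) = map_matrix cnj (matrix_inv R)"
    by (rule matrix_inv_unique)
  have "mat (cnj z) - map_matrix of_real A = map_matrix cnj R"
    by (simp add: R_def vec_eq_iff mat_def)
  moreover have "map_matrix of_real B = map_matrix cnj (map_matrix of_real B)"
    by (simp add: vec_eq_iff)
  ultimately show ?thesis
    unfolding Gtf_def R_def[symmetric] map_matrix_cnj_mult inv[symmetric] by simp
qed

lemma GTG_cnj:
  fixes A :: "real^'n^'n" and B :: "real^'m^'n"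
  assumes "schur_stable A" "z \<in> sphere 0 1"
  shows "GTG A B \<Theta> (cnj z) = map_matrix cnj (GTG A B \<Theta> z)"
proof -
  have "map_matrix cnj (map_matrix of_real \<Theta>) = map_matrix of_real \<Theta>"
    by (simp add: vec_eq_iff)
  thus ?thesis
    unfolding GTG_def Gtf_cnj[OF assms] map_matrix_cnj_mult map_matrix_cnj_ctranspose by simp
qed

lemma matrix_mult_scaleR: "X ** (c *\<^sub>R Y) = c *\<^sub>R (X ** (Y :: complex^'k^'n))"
  by (simp add: matrix_matrix_mult_def vec_eq_iff scaleR_sum_right)

lemma matrix_add_mult: "(X + Y) ** Z = X ** Z + Y ** (Z :: complex^'k^'n)"
  by (simp add: matrix_matrix_mult_def vec_eq_iff algebra_simps sum.distrib)

lemma GTG_midpoint: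
  fixes A :: "real^'n^'n" and B :: "real^'m^'n"
  shows "GTG A B ((1/2) *\<^sub>R (\<Theta>1 + \<Theta>2)) z = (1/2) *\<^sub>R (GTG A B \<Theta>1 z + GTG A B \<Theta>2 z)"
proof -
  have "map_matrix of_real ((1/2) *\<^sub>R (\<Theta>1 + \<Theta>2))
      = (1/2) *\<^sub>R (map_matrix of_real \<Theta>1 + map_matrix of_real \<Theta>2 :: complex^'n^'n)"
    by (simp add: vec_eq_iff complex_eq_iff)
  thus ?thesis
    by (simp only: GTG_def matrix_mult_scaleR matrix_add_ldistrib scalar_matrix_assoc[symmetric] matrix_add_mult)
qed

lemma rational_on_circle_imp_continuous:
  fixes F :: "complex \<Rightarrow> complex^'m^'k"
  assumes "rational_on_circle F"
  shows "continuous_on (sphere 0 1) F"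
proof -
  have "continuous_on (sphere 0 1) (\<lambda>z. F z $ i $ j)" for i j
  proof -
    obtain p q :: "complex poly" where pq: "\<forall>z\<in>sphere 0 1. poly q z \<noteq> 0 \<and> F z $ i $ j = poly p z / poly q z"
      using assms unfolding rational_on_circle_def by blast
    have "continuous_on (sphere 0 1) (\<lambda>z. poly p z / poly q z)"
      using pq by (intro continuous_intros) auto
    thus ?thesis
      by (rule continuous_on_cong[THEN iffD1, rotated 2]) (use pq in auto)
  qed
  hence "continuous_on (sphere 0 1) (\<lambda>z. \<chi> i j. F z $ i $ j)"
    by (intro continuous_on_vec_lambda)
  thus ?thesis by simp
qed

lemma continuous_on_correlogram: "continuous_on (sphere 0 1) (correlogram N y w)"
  unfolding correlogram_def by (intro continuous_intros) auto

lemma spectral_density_posdef: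
  assumes "\<Phi> \<in> spectral_densities" "z \<in> sphere 0 1"
  shows "posdef (\<Phi> z)"
proof -
  obtain k where k: "0 < k" "psd (\<Phi> z - mat (of_real k))" and h: "psd (\<Phi> z)"
    using assms unfolding spectral_densities_def by blast
  have ge: "k * (v \<bullet> v) \<le> v \<bullet> (\<Phi> z *v v)" for v
    using k(2)
    by (simp add: psd_def matrix_vector_mult_diff_rdistrib inner_diff_right mat_of_real_mult_vector)
  have "0 < v \<bullet> (\<Phi> z *v v)" if "v \<noteq> 0" for v
    using ge[of v] k(1) that by (meson inner_gt_zero_iff less_le_trans mult_pos_pos)
  thus ?thesis using h by (simp add: posdef_def psd_def)
qed

lemma spectral_densityI:
  fixes F :: "complex \<Rightarrow> complex^'n^'n"
  assumes F: "continuous_on (sphere 0 1) F" and pd: "\<And>z. z \<in> sphere 0 1 \<Longrightarrow> posdef (F z)"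
    and sym: "\<And>z. z \<in> sphere 0 1 \<Longrightarrow> F (cnj z) = map_matrix cnj (F z)"
  shows "F \<in> spectral_densities"
proof -
  have "(\<lambda>\<theta>. F (cis \<theta>)) \<in> borel_measurable borel"
    by (intro borel_measurable_continuous_onI continuous_on_cis[OF F]) auto
  thus ?thesis
    using posdef_coercive_on_circle[OF F pd] pd sym posdef_imp_psd
    unfolding spectral_densities_def by blast
qed

section \<open>The dual potential\<close>

text \<open>The scalar function whose trace functional of the pencil is the nonlinear part of the dual function,
  in both of its cases. Its derivative \<open>- \<nu> * x powr - \<nu>\<close> is given by one formula for all \<open>\<nu> \<ge> 1\<close>,
  which is what makes a common treatment possible.\<close>

definition dual_potential :: "nat \<Rightarrow> real \<Rightarrow> real"
  where "dual_potential \<nu> x =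
    (if \<nu> = 1 then - ln x else (real \<nu> / (real \<nu> - 1)) * x powr (1 - real \<nu>))"

lemma dual_potential_deriv:
  assumes "\<nu> \<ge> 1" "0 < x"
  shows "(dual_potential \<nu> has_real_derivative - (real \<nu> * x powr - real \<nu>)) (at x)"
proof (cases "\<nu> = 1")
  case True
  have "((\<lambda>x. - ln x) has_real_derivative - (real \<nu> * x powr - real \<nu>)) (at x)"
    using assms True by (auto intro!: derivative_eq_intros simp: powr_minus divide_inverse)
  thus ?thesis using True by (simp add: dual_potential_def[abs_def])
next
  case False
  hence "real \<nu> - 1 \<noteq> 0" by simp
  hence "(real \<nu> / (real \<nu> - 1)) * ((1 - real \<nu>) * x powr (1 - real \<nu> - 1)) = - (real \<nu> * x powr - real \<nu>)"
    by (simp add: field_simps)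
  hence "((\<lambda>x. (real \<nu> / (real \<nu> - 1)) * x powr (1 - real \<nu>)) has_real_derivative
      - (real \<nu> * x powr - real \<nu>)) (at x)"
    using DERIV_cmult[OF has_real_derivative_powr[OF assms(2), of "1 - real \<nu>"], of "real \<nu> / (real \<nu> - 1)"]
    by simp
  thus ?thesis using False by (simp add: dual_potential_def[abs_def])
qed

lemma dual_potential_strict_tangent:
  assumes "\<nu> \<ge> 1" "0 < x" "0 < y" "x \<noteq> y"
  shows "dual_potential \<nu> y + (x - y) * - (real \<nu> * y powr - real \<nu>) < dual_potential \<nu> x"
proof (rule strict_tangent_of_strict_mono_deriv[OF _ _ assms(2-)])
  show "(dual_potential \<nu> has_real_derivative - (real \<nu> * x powr - real \<nu>)) (at x)" if "0 < x" for x
    using dual_potential_deriv assms(1) that .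
  show "- (real \<nu> * x powr - real \<nu>) < - (real \<nu> * y powr - real \<nu>)" if "0 < x" "x < y" for x y
    using assms(1) that by (simp add: powr_less_mono2_neg)
qed

lemma continuous_on_dual_potential: "\<nu> \<ge> 1 \<Longrightarrow> continuous_on {0<..} (dual_potential \<nu>)"
  by (intro continuous_at_imp_continuous_on ballI DERIV_isCont) (use dual_potential_deriv in auto)

lemma continuous_on_powr_pos: "continuous_on {0<..} (\<lambda>x :: real. x powr p)"
  by (intro continuous_intros) auto

lemma continuous_on_mat_powr:
  fixes F :: "complex \<Rightarrow> complex^'n^'n"
  shows "continuous_on S F \<Longrightarrow> (\<And>z. z \<in> S \<Longrightarrow> posdef (F z)) \<Longrightarrow> continuous_on S (\<lambda>z. mat_powr (F z) p)"
  unfolding mat_powr_def by (rule continuous_on_herm_fun[OF _ _ continuous_on_powr_pos])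

lemma continuous_on_mat_log:
  fixes F :: "complex \<Rightarrow> complex^'n^'n"
  shows "continuous_on S F \<Longrightarrow> (\<And>z. z \<in> S \<Longrightarrow> posdef (F z)) \<Longrightarrow> continuous_on S (\<lambda>z. mat_log (F z))"
  unfolding mat_log_def by (rule continuous_on_herm_fun) (auto intro!: continuous_intros)

lemma continuous_on_Re_trace [continuous_intros]:
  fixes F :: "'a::topological_space \<Rightarrow> complex^'n^'n"
  shows "continuous_on S F \<Longrightarrow> continuous_on S (\<lambda>x. Re (trace (F x)))"
  unfolding trace_def by (intro continuous_intros)

lemma matrix_inv_posdef_powr:
  assumes "posdef X"
  shows "matrix_inv X = mat_powr X (- 1)"
  unfolding mat_powr_def matrix_inv_posdef[OF assms]
  by (rule herm_fun_cong[OF assms]) (simp add: powr_minus)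

lemma posdef_mat_powr: "posdef X \<Longrightarrow> posdef (mat_powr X p)"
  unfolding mat_powr_def by (rule posdef_herm_fun) auto

lemma mat_powr_mat_powr:
  assumes "posdef X"
  shows "mat_powr (mat_powr X p) q = mat_powr X (p * q)"
  unfolding mat_powr_def herm_fun_compose[OF posdef_imp_hermitian[OF assms]]
  by (rule herm_fun_cong[OF assms]) (simp add: powr_powr)

lemma mat_powr_one:
  assumes "posdef X"
  shows "mat_powr X 1 = X"
proof -
  have "mat_powr X 1 = herm_fun (\<lambda>x. x) X"
    unfolding mat_powr_def by (rule herm_fun_cong[OF assms]) simp
  thus ?thesis using herm_fun_ident[OF posdef_imp_hermitian[OF assms]] by simp
qed

lemma mat_log_mat_powr_uminus_one:
  assumes "posdef X"
  shows "mat_log (mat_powr X (- 1)) = herm_fun (dual_potential 1) X"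
  unfolding mat_log_def mat_powr_def herm_fun_compose[OF posdef_imp_hermitian[OF assms]]
  by (rule herm_fun_cong[OF assms]) (simp add: dual_potential_def ln_div)

lemma herm_fun_dual_potential:
  assumes "posdef X" "\<nu> \<noteq> 1"
  shows "herm_fun (dual_potential \<nu>) X = (real \<nu> / (real \<nu> - 1)) *\<^sub>R mat_powr X (1 - real \<nu>)"
  unfolding mat_powr_def herm_fun_scaleR[OF posdef_imp_hermitian[OF assms(1)], symmetric]
  using assms(2) by (intro herm_fun_cong[OF assms(1)]) (simp add: dual_potential_def)

lemma trace_scaleR: "trace (c *\<^sub>R X) = c *\<^sub>R trace (X :: complex^'n^'n)"
  by (simp add: trace_def scaleR_sum_right)

section \<open>The divergence from the correlogram as a dual function\<close>

text \<open>Cyclicity of the trace moves the linear term of the dual function under the integral, where it pairs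
  \<open>\<Omega>\<close> with the \<open>\<Theta>\<close>-dependent part of the pencil.\<close>

lemma trace_state_cov:
  fixes A :: "real^'n^'n" and B :: "real^'m^'n"
  assumes A: "schur_stable A" and \<Omega>: "continuous_on (sphere 0 1) \<Omega>"
  shows "Re (trace (state_cov A B \<Omega> ** map_matrix of_real \<Theta>))
       = circle_integral (\<lambda>z. Re (trace (\<Omega> z ** GTG A B \<Theta> z)))"
proof -
  define L where "L X = Re (trace (X ** map_matrix of_real \<Theta>))" for X :: "complex^'n^'n"
  have "linear L"
    unfolding L_def
    by (rule linearI) (simp_all add: trace_def matrix_matrix_mult_def algebra_simps sum.distrib
        sum_distrib_left sum_distrib_right)
  hence "bounded_linear L" by (simp add: linear_conv_bounded_linear)
  moreover have "continuous_on (sphere 0 1) (\<lambda>z. Gtf A B z ** \<Omega> z ** ctranspose (Gtf A B z))"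
    by (intro continuous_intros continuous_on_Gtf A \<Omega>)
  ultimately have "L (state_cov A B \<Omega>)
      = circle_integral (\<lambda>z. L (Gtf A B z ** \<Omega> z ** ctranspose (Gtf A B z)))"
    unfolding state_cov_def by (rule circle_integral_bounded_linear[symmetric])
  moreover have "L (Gtf A B z ** \<Omega> z ** ctranspose (Gtf A B z)) = Re (trace (\<Omega> z ** GTG A B \<Theta> z))" for z
    using trace_mul_sym[of "Gtf A B z" "\<Omega> z ** ctranspose (Gtf A B z) ** map_matrix of_real \<Theta>"]
    by (simp add: L_def GTG_def matrix_mul_assoc)
  ultimately show ?thesis by (simp add: L_def)
qed

context
  fixes A :: "real^'n^'n" and B :: "real^'m^'n"
    and \<Psi> :: "complex \<Rightarrow> complex^'m^'m" and \<nu> :: nat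
  assumes A: "schur_stable A" and nu: "\<nu> \<ge> 1"
    and \<Psi>: "\<And>z. z \<in> sphere 0 1 \<Longrightarrow> posdef (\<Psi> z)" and \<Psi>_cont: "continuous_on (sphere 0 1) \<Psi>"
begin

lemma continuous_on_pencil: "continuous_on (sphere 0 1) (pencil A B \<Psi> \<nu> \<Theta>)"
  unfolding pencil_def by (intro continuous_intros continuous_on_GTG continuous_on_mat_powr A \<Psi> \<Psi>_cont)

lemma dual_fun_eq_circle_integral:
  assumes \<Omega>: "continuous_on (sphere 0 1) \<Omega>" and \<Theta>: "\<Theta> \<in> dual_domain A B \<Psi> \<nu>"
  shows "dual_fun A B \<Psi> \<nu> (state_cov A B \<Omega>) \<Theta>
    = circle_integral (\<lambda>z. Re (trace (herm_fun (dual_potential \<nu>) (pencil A B \<Psi> \<nu> \<Theta> z)))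
                         + Re (trace (\<Omega> z ** GTG A B \<Theta> z)))"
proof -
  define P where "P = pencil A B \<Psi> \<nu> \<Theta>"
  have P: "posdef (P z)" if "z \<in> sphere 0 1" for z
    using \<Theta> that by (simp add: P_def dual_domain_def)
  have P_cont: "continuous_on (sphere 0 1) P" unfolding P_def by (rule continuous_on_pencil)
  have \<phi>_cont: "continuous_on (sphere 0 1) (\<lambda>z. herm_fun (dual_potential \<nu>) (P z))"
    by (intro continuous_on_herm_fun P_cont P continuous_on_dual_potential nu)
  have "dual_fun A B \<Psi> \<nu> (state_cov A B \<Omega>) \<Theta>
      = Re (trace (circle_integral (\<lambda>z. herm_fun (dual_potential \<nu>) (P z))))
        + Re (trace (state_cov A B \<Omega> ** map_matrix of_real \<Theta>))"
  proof (cases "\<nu> = 1")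
    case True
    have "mat_log (matrix_inv (matrix_inv (\<Psi> z) + GTG A B \<Theta> z)) = herm_fun (dual_potential \<nu>) (P z)"
      if z: "z \<in> sphere 0 1" for z
    proof -
      have "matrix_inv (\<Psi> z) + GTG A B \<Theta> z = P z"
        using True by (simp add: P_def pencil_def matrix_inv_posdef_powr[OF \<Psi>[OF z]])
      thus ?thesis
        using True by (simp add: matrix_inv_posdef_powr[OF P[OF z]] mat_log_mat_powr_uminus_one[OF P[OF z]])
    qed
    hence "circle_integral (\<lambda>z. mat_log (matrix_inv (matrix_inv (\<Psi> z) + GTG A B \<Theta> z)))
        = circle_integral (\<lambda>z. herm_fun (dual_potential \<nu>) (P z))"
      by (rule circle_integral_cong)
    thus ?thesis
      using True by (simp add: dual_fun_def)
  next
    case False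
    define c where "c = real \<nu> / (real \<nu> - 1)"
    have pc: "continuous_on (sphere 0 1) (\<lambda>z. mat_powr (P z) (1 - real \<nu>))"
      by (intro continuous_on_mat_powr P_cont P)
    have "circle_integral (\<lambda>z. herm_fun (dual_potential \<nu>) (P z))
        = circle_integral (\<lambda>z. c *\<^sub>R mat_powr (P z) (1 - real \<nu>))"
      unfolding c_def by (intro circle_integral_cong herm_fun_dual_potential P False)
    also have "\<dots> = c *\<^sub>R circle_integral (\<lambda>z. mat_powr (P z) (1 - real \<nu>))"
      by (rule circle_integral_bounded_linear[OF bounded_linear_scaleR_right pc])
    finally show ?thesis
      using False by (simp add: dual_fun_def trace_scaleR c_def P_def)
  qed
  also have "\<dots> = circle_integral (\<lambda>z. Re (trace (herm_fun (dual_potential \<nu>) (P z))))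
      + circle_integral (\<lambda>z. Re (trace (\<Omega> z ** GTG A B \<Theta> z)))"
    unfolding circle_integral_Re_trace[OF \<phi>_cont] trace_state_cov[OF A \<Omega>] ..
  also have "\<dots> = circle_integral (\<lambda>z. Re (trace (herm_fun (dual_potential \<nu>) (P z)))
                         + Re (trace (\<Omega> z ** GTG A B \<Theta> z)))"
    by (intro circle_integral_add[symmetric] continuous_intros \<phi>_cont \<Omega> continuous_on_GTG A)
  finally show ?thesis unfolding P_def .
qed

text \<open>With \<open>\<beta> = 1 - 1/\<nu>\<close> and \<open>P\<close> the pencil, the density \<open>P\<^sup>-\<^sup>\<nu>\<close> enters the divergence only through
  \<open>(P\<^sup>-\<^sup>\<nu>)\<^sup>\<beta>\<^sup>-\<^sup>1 = P\<close> and \<open>(P\<^sup>-\<^sup>\<nu>)\<^sup>\<beta> = P\<^sup>1\<^sup>-\<^sup>\<nu>\<close>. The cross term with \<open>\<Omega>\<close> is therefore affine in \<open>\<Theta>\<close> and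
  gives \<open>trace (\<Omega> P)\<close>, whose \<open>\<Theta>\<close>-part integrates to \<open>trace (\<Sigma> \<Theta>)\<close> for the state covariance \<open>\<Sigma>\<close>;
  the last term is the dual potential of \<open>P\<close>. For \<open>\<nu> = 1\<close> the logarithm takes the place of the power.\<close>

lemma beta_div_eq_dual_fun_plus_const:
  assumes \<Omega>: "continuous_on (sphere 0 1) \<Omega>" and \<Omega>_pd: "\<And>z. z \<in> sphere 0 1 \<Longrightarrow> posdef (\<Omega> z)"
  shows "\<exists>C. \<forall>\<Theta>\<in>dual_domain A B \<Psi> \<nu>.
    beta_div (1 - 1 / real \<nu>) \<Omega> (beta_density A B \<Psi> \<nu> \<Theta>)
      = C + dual_fun A B \<Psi> \<nu> (state_cov A B \<Omega>) \<Theta>"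
proof -
  define \<beta> where "\<beta> = 1 - 1 / real \<nu>"
  define c where "c = 1 / (\<beta> * (\<beta> - 1))"
  define R where "R z = mat_powr (\<Psi> z) (- (1 / real \<nu>))" for z
  \<comment> \<open>The part of the integrand that does not involve \<open>\<Theta>\<close>.\<close>
  define ref where "ref z = real \<nu> * Re (trace (\<Omega> z ** R z))
    + (if \<nu> = 1 then - Re (trace (mat_log (\<Omega> z))) - real CARD('m)
       else c * Re (trace (mat_powr (\<Omega> z) \<beta>)))" for z
  have R_cont: "continuous_on (sphere 0 1) R"
    unfolding R_def by (intro continuous_on_mat_powr \<Psi> \<Psi>_cont)
  have "continuous_on (sphere 0 1) (\<lambda>z. if \<nu> = 1 then - Re (trace (mat_log (\<Omega> z))) - real CARD('m)
       else c * Re (trace (mat_powr (\<Omega> z) \<beta>)))"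
    by (cases "\<nu> = 1")
      (auto intro!: continuous_intros continuous_on_mat_log continuous_on_mat_powr \<Omega> \<Omega>_pd)
  hence ref_cont: "continuous_on (sphere 0 1) ref"
    unfolding ref_def by (intro continuous_intros \<Omega> R_cont)
  show ?thesis
  proof (intro exI[of _ "circle_integral ref"] ballI)
    fix \<Theta> assume \<Theta>: "\<Theta> \<in> dual_domain A B \<Psi> \<nu>"
    define P where "P = pencil A B \<Psi> \<nu> \<Theta>"
    define j where "j z = Re (trace (herm_fun (dual_potential \<nu>) (P z)))
                         + Re (trace (\<Omega> z ** GTG A B \<Theta> z))" for z
    have P: "posdef (P z)" if "z \<in> sphere 0 1" for z
      using \<Theta> that by (simp add: P_def dual_domain_def)
    have P_cont: "continuous_on (sphere 0 1) P" unfolding P_def by (rule continuous_on_pencil)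
    have \<phi>_cont: "continuous_on (sphere 0 1) (\<lambda>z. herm_fun (dual_potential \<nu>) (P z))"
      by (intro continuous_on_herm_fun P_cont P continuous_on_dual_potential nu)
    have j_cont: "continuous_on (sphere 0 1) j"
      unfolding j_def by (intro continuous_intros \<phi>_cont \<Omega> continuous_on_GTG A)
    have density: "beta_density A B \<Psi> \<nu> \<Theta> = (\<lambda>z. mat_powr (P z) (- real \<nu>))"
      by (simp add: beta_density_def P_def fun_eq_iff)
    have lin: "real \<nu> * Re (trace (\<Omega> z ** P z))
        = real \<nu> * Re (trace (\<Omega> z ** R z)) + Re (trace (\<Omega> z ** GTG A B \<Theta> z))" for z
      using nu by (simp add: P_def pencil_def R_def matrix_add_ldistrib matrix_mult_scaleR trace_add
          trace_scaleR algebra_simps)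
    have "beta_div \<beta> \<Omega> (beta_density A B \<Psi> \<nu> \<Theta>) = circle_integral (\<lambda>z. ref z + j z)"
    proof (cases "\<nu> = 1")
      case True
      have integrand: "mat_log (mat_powr (P z) (- real \<nu>)) - mat_log (\<Omega> z)
            + \<Omega> z ** matrix_inv (mat_powr (P z) (- real \<nu>)) - mat 1
          = herm_fun (dual_potential \<nu>) (P z) - mat_log (\<Omega> z) + \<Omega> z ** P z - mat 1"
        if z: "z \<in> sphere 0 1" for z
        using True
        by (simp add: mat_log_mat_powr_uminus_one[OF P[OF z]]
            matrix_inv_posdef_powr[OF posdef_mat_powr[OF P[OF z]]]
            mat_powr_mat_powr[OF P[OF z]] mat_powr_one[OF P[OF z]])
      have "\<beta> = 0" using True by (simp add: \<beta>_def)
      hence "beta_div \<beta> \<Omega> (beta_density A B \<Psi> \<nu> \<Theta>) = Re (trace (circle_integral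
          (\<lambda>z. herm_fun (dual_potential \<nu>) (P z) - mat_log (\<Omega> z) + \<Omega> z ** P z - mat 1)))"
        unfolding beta_div_def is_div_def density
        by (simp only: if_True simp_thms circle_integral_cong[OF integrand])
      also have "\<dots> = circle_integral (\<lambda>z. Re (trace
          (herm_fun (dual_potential \<nu>) (P z) - mat_log (\<Omega> z) + \<Omega> z ** P z - mat 1)))"
        by (intro circle_integral_Re_trace continuous_intros \<phi>_cont continuous_on_mat_log \<Omega> \<Omega>_pd P_cont)
      also have "\<dots> = circle_integral (\<lambda>z. ref z + j z)"
        using lin True
        by (intro circle_integral_cong) (simp add: trace_add trace_sub trace_I ref_def j_def)
      finally show ?thesis .
    next
      case False
      hence \<nu>: "real \<nu> > 1" using nu by simp
      hence \<beta>: "\<beta> \<noteq> 0" "1 / (\<beta> - 1) = - real \<nu>" "1 / \<beta> = real \<nu> / (real \<nu> - 1)"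
        "- real \<nu> * (\<beta> - 1) = 1" "- real \<nu> * \<beta> = 1 - real \<nu>"
        by (auto simp: \<beta>_def field_simps)
      have integrand: "c *\<^sub>R mat_powr (\<Omega> z) \<beta>
            - (1 / (\<beta> - 1)) *\<^sub>R (\<Omega> z ** mat_powr (mat_powr (P z) (- real \<nu>)) (\<beta> - 1))
            + (1 / \<beta>) *\<^sub>R mat_powr (mat_powr (P z) (- real \<nu>)) \<beta>
          = c *\<^sub>R mat_powr (\<Omega> z) \<beta> + real \<nu> *\<^sub>R (\<Omega> z ** P z)
            + herm_fun (dual_potential \<nu>) (P z)"
        if z: "z \<in> sphere 0 1" for z
        unfolding mat_powr_mat_powr[OF P[OF z]] herm_fun_dual_potential[OF P[OF z] False] \<beta>
          mat_powr_one[OF P[OF z]] by simp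
      have "beta_div \<beta> \<Omega> (beta_density A B \<Psi> \<nu> \<Theta>) = Re (trace (circle_integral
          (\<lambda>z. c *\<^sub>R mat_powr (\<Omega> z) \<beta> + real \<nu> *\<^sub>R (\<Omega> z ** P z)
            + herm_fun (dual_potential \<nu>) (P z))))"
        unfolding beta_div_def density c_def[symmetric] using \<beta>(1)
        by (simp only: if_False circle_integral_cong[OF integrand])
      also have "\<dots> = circle_integral (\<lambda>z. Re (trace
          (c *\<^sub>R mat_powr (\<Omega> z) \<beta> + real \<nu> *\<^sub>R (\<Omega> z ** P z)
            + herm_fun (dual_potential \<nu>) (P z))))"
        by (intro circle_integral_Re_trace continuous_intros \<phi>_cont continuous_on_mat_powr \<Omega> \<Omega>_pd P_cont)
      also have "\<dots> = circle_integral (\<lambda>z. ref z + j z)"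
        using lin False
        by (intro circle_integral_cong) (simp add: trace_add trace_scaleR ref_def j_def)
      finally show ?thesis .
    qed
    also have "\<dots> = circle_integral ref + circle_integral j"
      by (rule circle_integral_add[OF ref_cont j_cont])
    also have "circle_integral j = dual_fun A B \<Psi> \<nu> (state_cov A B \<Omega>) \<Theta>"
      unfolding dual_fun_eq_circle_integral[OF \<Omega> \<Theta>] j_def P_def ..
    finally show "beta_div (1 - 1 / real \<nu>) \<Omega> (beta_density A B \<Psi> \<nu> \<Theta>)
      = circle_integral ref + dual_fun A B \<Psi> \<nu> (state_cov A B \<Omega>) \<Theta>"
      unfolding \<beta>_def .
  qed
qed

lemma pencil_midpoint:
  "pencil A B \<Psi> \<nu> ((1/2) *\<^sub>R (\<Theta>1 + \<Theta>2)) z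
     = (1/2) *\<^sub>R (pencil A B \<Psi> \<nu> \<Theta>1 z + pencil A B \<Psi> \<nu> \<Theta>2 z)"
proof -
  have "R + c *\<^sub>R ((1/2) *\<^sub>R (X + Y)) = (1/2) *\<^sub>R ((R + c *\<^sub>R X) + (R + c *\<^sub>R Y))"
    for R X Y :: "complex^'m^'m" and c :: real
  proof -
    have "(R + c *\<^sub>R X) + (R + c *\<^sub>R Y) = (R + R) + c *\<^sub>R (X + Y)"
      by (simp add: scaleR_add_right)
    thus ?thesis by (simp only: scaleR_add_right[of "1/2" "R + R"] scaleR_half_double scaleR_left_commute)
  qed
  thus ?thesis unfolding pencil_def GTG_midpoint .
qed

lemma dual_domain_midpoint:
  assumes "\<Theta>1 \<in> dual_domain A B \<Psi> \<nu>" "\<Theta>2 \<in> dual_domain A B \<Psi> \<nu>"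
  shows "(1/2) *\<^sub>R (\<Theta>1 + \<Theta>2) \<in> dual_domain A B \<Psi> \<nu>"
  using assms by (auto simp: dual_domain_def pencil_midpoint intro!: posdef_midpoint)
    (simp add: transpose_def vec_eq_iff)

text \<open>The integrand of the dual function is strictly midpoint convex in the pencil, and the linear term
  contributes nothing to the convexity gap. Two minimisers whose pencils differed somewhere on the
  circle would have a midpoint with a smaller value. The parameters themselves need not agree, since
  \<open>\<Theta> \<mapsto> G\<^sup>* \<Theta> G\<close> may have a kernel.\<close>

lemma dual_minimizers_same_pencil:
  assumes \<Omega>: "continuous_on (sphere 0 1) \<Omega>"
    and \<Theta>1: "\<Theta>1 \<in> dual_domain A B \<Psi> \<nu>" and \<Theta>2: "\<Theta>2 \<in> dual_domain A B \<Psi> \<nu>"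
    and eq: "dual_fun A B \<Psi> \<nu> (state_cov A B \<Omega>) \<Theta>1 = dual_fun A B \<Psi> \<nu> (state_cov A B \<Omega>) \<Theta>2"
    and min: "\<And>\<Theta>. \<Theta> \<in> dual_domain A B \<Psi> \<nu> \<Longrightarrow>
      dual_fun A B \<Psi> \<nu> (state_cov A B \<Omega>) \<Theta>2 \<le> dual_fun A B \<Psi> \<nu> (state_cov A B \<Omega>) \<Theta>"
    and z: "z \<in> sphere 0 1"
  shows "pencil A B \<Psi> \<nu> \<Theta>1 z = pencil A B \<Psi> \<nu> \<Theta>2 z"
proof -
  define M where "M = (1/2) *\<^sub>R (\<Theta>1 + \<Theta>2)"
  define h where "h \<Theta> z = Re (trace (herm_fun (dual_potential \<nu>) (pencil A B \<Psi> \<nu> \<Theta> z)))" for \<Theta> z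
  define l where "l \<Theta> z = Re (trace (\<Omega> z ** GTG A B \<Theta> z))" for \<Theta> z
  \<comment> \<open>The convexity gap of the integrand at the midpoint; its linear part \<open>l\<close> cancels.\<close>
  define gap where "gap z = (h \<Theta>1 z + h \<Theta>2 z) - 2 * h M z" for z
  have M: "M \<in> dual_domain A B \<Psi> \<nu>" unfolding M_def using \<Theta>1 \<Theta>2 by (rule dual_domain_midpoint)
  have pd: "posdef (pencil A B \<Psi> \<nu> \<Theta> z)" if "\<Theta> \<in> dual_domain A B \<Psi> \<nu>" "z \<in> sphere 0 1" for \<Theta> z
    using that by (simp add: dual_domain_def)
  have h_cont: "continuous_on (sphere 0 1) (h \<Theta>)" if "\<Theta> \<in> dual_domain A B \<Psi> \<nu>" for \<Theta>
    unfolding h_def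
    by (intro continuous_intros continuous_on_herm_fun continuous_on_pencil pd that
        continuous_on_dual_potential nu)
  have l_cont: "continuous_on (sphere 0 1) (l \<Theta>)" for \<Theta>
    unfolding l_def by (intro continuous_intros \<Omega> continuous_on_GTG A)
  have l_mid: "l M z = (l \<Theta>1 z + l \<Theta>2 z) / 2" for z
    unfolding l_def M_def GTG_midpoint by (simp add: matrix_mult_scaleR matrix_add_ldistrib trace_scaleR trace_add)
  have J: "dual_fun A B \<Psi> \<nu> (state_cov A B \<Omega>) \<Theta> = circle_integral (\<lambda>z. h \<Theta> z + l \<Theta> z)"
    if "\<Theta> \<in> dual_domain A B \<Psi> \<nu>" for \<Theta>
    unfolding h_def l_def by (rule dual_fun_eq_circle_integral[OF \<Omega> that])
  have gap_cont: "continuous_on (sphere 0 1) gap"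
    unfolding gap_def by (intro continuous_intros h_cont \<Theta>1 \<Theta>2 M)
  note mid = trace_herm_fun_midpoint[OF pd[OF \<Theta>1] pd[OF \<Theta>2] dual_potential_strict_tangent[OF nu]]
  have gap_nonneg: "0 \<le> gap z" if "z \<in> sphere 0 1" for z
    using mid(1)[OF that that] by (simp add: gap_def h_def M_def pencil_midpoint)
  have "circle_integral gap + 2 * circle_integral (\<lambda>z. h M z + l M z)
      = circle_integral gap + circle_integral (\<lambda>z. 2 * (h M z + l M z))"
    by (subst circle_integral_bounded_linear[OF bounded_linear_mult_right])
      (auto intro!: continuous_intros h_cont l_cont M)
  also have "\<dots> = circle_integral (\<lambda>z. gap z + 2 * (h M z + l M z))"
    by (intro circle_integral_add[symmetric] continuous_intros gap_cont h_cont l_cont M)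
  also have "(\<lambda>z. gap z + 2 * (h M z + l M z)) = (\<lambda>z. (h \<Theta>1 z + l \<Theta>1 z) + (h \<Theta>2 z + l \<Theta>2 z))"
    by (simp add: gap_def l_mid fun_eq_iff)
  also have "circle_integral \<dots>
      = circle_integral (\<lambda>z. h \<Theta>1 z + l \<Theta>1 z) + circle_integral (\<lambda>z. h \<Theta>2 z + l \<Theta>2 z)"
    by (intro circle_integral_add continuous_intros h_cont l_cont \<Theta>1 \<Theta>2)
  finally have "circle_integral gap + 2 * dual_fun A B \<Psi> \<nu> (state_cov A B \<Omega>) M
      = 2 * dual_fun A B \<Psi> \<nu> (state_cov A B \<Omega>) \<Theta>2"
    using eq J \<Theta>1 \<Theta>2 M by simp
  hence "circle_integral gap \<le> 0" using min[OF M] by linarith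
  moreover have "0 \<le> circle_integral gap" by (rule circle_integral_nonneg[OF gap_nonneg])
  ultimately have "gap z = 0"
    using circle_integral_eq_0_imp[OF gap_cont gap_nonneg _ z] by simp
  thus ?thesis
    using mid(2)[OF z z] by (simp add: gap_def h_def M_def pencil_midpoint)
qed

lemma beta_density_spectral_density:
  assumes \<Psi>_sym: "\<And>z. z \<in> sphere 0 1 \<Longrightarrow> \<Psi> (cnj z) = map_matrix cnj (\<Psi> z)"
    and \<Theta>: "\<Theta> \<in> dual_domain A B \<Psi> \<nu>"
  shows "beta_density A B \<Psi> \<nu> \<Theta> \<in> spectral_densities"
proof (rule spectral_densityI)
  have pd: "posdef (pencil A B \<Psi> \<nu> \<Theta> z)" if "z \<in> sphere 0 1" for z
    using \<Theta> that by (simp add: dual_domain_def)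
  show "continuous_on (sphere 0 1) (beta_density A B \<Psi> \<nu> \<Theta>)"
    unfolding beta_density_def by (intro continuous_on_mat_powr continuous_on_pencil pd)
  fix z :: complex assume z: "z \<in> sphere 0 1"
  show "posdef (beta_density A B \<Psi> \<nu> \<Theta> z)"
    unfolding beta_density_def by (rule posdef_mat_powr[OF pd[OF z]])
  have "mat_powr (\<Psi> (cnj z)) p = map_matrix cnj (mat_powr (\<Psi> z) p)" for p
    unfolding \<Psi>_sym[OF z] mat_powr_def
    by (rule herm_fun_cnj[OF posdef_imp_hermitian[OF \<Psi>[OF z]]])
  hence "pencil A B \<Psi> \<nu> \<Theta> (cnj z) = map_matrix cnj (pencil A B \<Psi> \<nu> \<Theta> z)"
    unfolding pencil_def GTG_cnj[OF A z] by (simp add: vec_eq_iff)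
  thus "beta_density A B \<Psi> \<nu> \<Theta> (cnj z) = map_matrix cnj (beta_density A B \<Psi> \<nu> \<Theta> z)"
    unfolding beta_density_def mat_powr_def
    using herm_fun_cnj[OF posdef_imp_hermitian[OF pd[OF z]]] by simp
qed

end

theorem proposition5:
  fixes A :: "real^'n^'n" and B :: "real^'m^'n"
    and \<Psi> \<Omega> :: "complex \<Rightarrow> complex^'m^'m"
    and \<nu> N M :: nat and y :: "nat \<Rightarrow> real^'m" and w :: "int \<Rightarrow> real"
    and \<Theta>hat :: "real^'n^'n"
  assumes "schur_stable A" and "reachable A B" and "CARD('n) > CARD('m)"
    and "\<nu> \<ge> 1"
    and "\<Psi> \<in> spectral_densities"
    and "rational_on_circle \<Psi>"
    and "rational_on_circle (\<lambda>z. mat_powr (\<Psi> z) (1 / real \<nu>))"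
    and "1 \<le> M" and "M \<le> N" and "lag_window M w"
    and "\<Omega> = correlogram N y w"
    and "\<forall>z\<in>sphere 0 1. posdef (\<Omega> z)"
    and "is_arg_min (dual_fun A B \<Psi> \<nu> (state_cov A B \<Omega>)) (\<lambda>\<Theta>. \<Theta> \<in> dual_domain A B \<Psi> \<nu>) \<Theta>hat"
  shows "is_arg_min (\<lambda>\<Theta>. beta_div (1 - 1 / real \<nu>) \<Omega> (beta_density A B \<Psi> \<nu> \<Theta>))
           (\<lambda>\<Theta>. \<Theta> \<in> dual_domain A B \<Psi> \<nu>) \<Theta>hat
    \<and> beta_density A B \<Psi> \<nu> \<Theta>hat \<in> spectral_densities \<inter> beta_class A B \<Psi> \<nu>
    \<and> (\<forall>\<Phi> \<in> beta_class A B \<Psi> \<nu>.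
         beta_div (1 - 1 / real \<nu>) \<Omega> (beta_density A B \<Psi> \<nu> \<Theta>hat) \<le> beta_div (1 - 1 / real \<nu>) \<Omega> \<Phi>
         \<and> (beta_div (1 - 1 / real \<nu>) \<Omega> \<Phi> = beta_div (1 - 1 / real \<nu>) \<Omega> (beta_density A B \<Psi> \<nu> \<Theta>hat)
            \<longrightarrow> (\<forall>z\<in>sphere 0 1. \<Phi> z = beta_density A B \<Psi> \<nu> \<Theta>hat z)))"
proof -
  let ?D = "dual_domain A B \<Psi> \<nu>"
  let ?J = "dual_fun A B \<Psi> \<nu> (state_cov A B \<Omega>)"
  let ?S = "\<lambda>\<Theta>. beta_div (1 - 1 / real \<nu>) \<Omega> (beta_density A B \<Psi> \<nu> \<Theta>)"
  note A = assms(1) and nu = assms(4)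
  have \<Psi>: "posdef (\<Psi> z)" if "z \<in> sphere 0 1" for z
    using spectral_density_posdef assms(5) that .
  have \<Psi>_sym: "\<Psi> (cnj z) = map_matrix cnj (\<Psi> z)" if "z \<in> sphere 0 1" for z
    using assms(5) that by (simp add: spectral_densities_def)
  have \<Psi>_cont: "continuous_on (sphere 0 1) \<Psi>"
    using assms(6) by (rule rational_on_circle_imp_continuous)
  have \<Omega>: "continuous_on (sphere 0 1) \<Omega>"
    unfolding \<open>\<Omega> = correlogram N y w\<close> by (rule continuous_on_correlogram)
  have \<Omega>_pd: "posdef (\<Omega> z)" if "z \<in> sphere 0 1" for z
    using assms(12) that by blast
  have "\<exists>C. \<forall>\<Theta>\<in>?D. ?S \<Theta> = C + ?J \<Theta>"
    by (rule beta_div_eq_dual_fun_plus_const[OF A nu \<Psi> \<Psi>_cont \<Omega> \<Omega>_pd])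
  then obtain C where C: "\<And>\<Theta>. \<Theta> \<in> ?D \<Longrightarrow> ?S \<Theta> = C + ?J \<Theta>" by blast
  have hat: "\<Theta>hat \<in> ?D" and min: "\<And>\<Theta>. \<Theta> \<in> ?D \<Longrightarrow> ?J \<Theta>hat \<le> ?J \<Theta>"
    using assms(13) by (auto simp: is_arg_min_def not_less)
  have S_min: "?S \<Theta>hat \<le> ?S \<Theta>" if "\<Theta> \<in> ?D" for \<Theta>
    using C[OF that] C[OF hat] min[OF that] by simp
  have "is_arg_min ?S (\<lambda>\<Theta>. \<Theta> \<in> ?D) \<Theta>hat"
    using hat S_min by (auto simp: is_arg_min_def not_less)
  moreover have "beta_density A B \<Psi> \<nu> \<Theta>hat \<in> spectral_densities \<inter> beta_class A B \<Psi> \<nu>"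
    using beta_density_spectral_density[OF A nu \<Psi> \<Psi>_cont \<Psi>_sym hat] hat by (simp add: beta_class_def)
  moreover have "beta_density A B \<Psi> \<nu> \<Theta> z = beta_density A B \<Psi> \<nu> \<Theta>hat z"
    if "\<Theta> \<in> ?D" "?S \<Theta> = ?S \<Theta>hat" "z \<in> sphere 0 1" for \<Theta> z
  proof -
    have "?J \<Theta> = ?J \<Theta>hat" using C[OF that(1)] C[OF hat] that(2) by simp
    hence "pencil A B \<Psi> \<nu> \<Theta> z = pencil A B \<Psi> \<nu> \<Theta>hat z"
      using dual_minimizers_same_pencil[OF A nu \<Psi> \<Psi>_cont \<Omega> that(1) hat _ min that(3)] by blast
    thus ?thesis by (simp add: beta_density_def)
  qed
  ultimately show ?thesis
    using S_min unfolding beta_class_def by blast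
qed

end
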